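(* Let $X=(x_0,x_1)$ be a bounded interval and let $\zeta\in C_{{\rm pw},+}(X)$. Suppose $\zeta\notin C(X)$, and denote by $y_j$ $(1\le j\le n)$ the points of discontinuity of $\zeta$, indexed in their natural order $x_0<y_1<\cdots<y_n<x_1$, with $y_0=x_0$ and $y_{n+1}=x_1$. For $1\le j\le n+1$ set $\zeta_j=\zeta|_{(y_{j-1},y_j)}$, and for $1\le j\le n$ write $$r_j=\frac{\zeta(y_j-)-\zeta(y_j+)}{\zeta(y_j-)+\zeta(y_j+)}.$$ Then $$g_\zeta=g_{\zeta_1}\circ\varphi_{1,r_1}\circ\cdots\circ g_{\zeta_n}\circ\varphi_{1,r_n}\circ g_{\zeta_{n+1}},$$ meaning that for almost every $\omega\in\mathbb{R}$, $g_\zeta^\omega=g_{\zeta_1}^\omega\circ\varphi_{1,r_1}\circ\cdots\circ g_{\zeta_n}^\omega\circ\varphi_{1,r_n}\circ g_{\zeta_{n+1}}^\omega$ as maps on $\mathbb{D}$.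
   Context: $\mathbb{D}$ is the open unit disk; $\varphi_{\mu,\rho}(\xi)=\mu\frac{\xi+\rho}{1+\bar\rho\xi}$ for $\mu\in S^1$ (unit circle) and $\rho\in\mathbb{D}$. For a bounded interval $Y$: $\mathrm{Step}(Y)$ is the set of piecewise-constant complex-valued functions on $Y$ with finitely many discontinuities; $\mathrm{Reg}(Y)$ is its closure in $L^\infty(Y)$; $\mathrm{Reg}_+(Y)=\{f\in\mathrm{Reg}(Y): \exists\varepsilon>0,\ f>\varepsilon \text{ on } Y\}$. $C_{\rm pw}(Y)$ is the set of $f:Y\to\mathbb{C}$ for which there is a finite partition of $Y$ such that $f$ is absolutely continuous on each open subinterval of the partition; $C_{{\rm pw},+}(Y)=C_{\rm pw}(Y)\cap\mathrm{Reg}_+(Y)$. Functions equal a.e. are identified and representatives without removable discontinuities are used. One-sided limits are written $f(x\pm)$. Generalized reflection coefficient: for $\omega\in\mathbb{R}\setminus\{0\}$ put $u^{\ell}=\frac12\bigl(u-\frac{1}{i\omega}u'\bigr)$ and $u^{\rm r}=\frac12\bigl(u+\frac{1}{i\omega}u'\bigr)$. For $Y=(a,b)$ and $\eta\in\mathrm{Reg}_+(Y)$, for all $\omega\in\mathbb{R}$ outside a countable set (containing $0$) and every $\xi\in\mathbb{D}$, the problem $(\eta u')'+\omega^2\eta u=0$ on $Y$, $u^{\rm r}(a+)=1$, $u^{\ell}(b-)=\xi u^{\rm r}(b-)$ has a unique solution $u$ with $u$ and $\eta u'$ absolutely continuous (equation holding a.e.); one defines $g_\eta^\omega(\xi)=u^{\ell}(a+)$.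 When $\eta$ has bounded variation, $g_\eta^\omega$ is a holomorphic bijection of $\mathbb{D}$. $g_\eta$ denotes the a.e.-defined map $\omega\mapsto g_\eta^\omega$. *)

theory Defs
  imports "HOL-Analysis.Analysis"
begin

definition disk_automorphism :: "complex \<Rightarrow> complex \<Rightarrow> complex \<Rightarrow> complex" where
  "disk_automorphism \<mu> \<rho> \<xi> = \<mu> * ((\<xi> + \<rho>) / (1 + cnj \<rho> * \<xi>))"

text \<open>Absolute continuity of a function (the library constant \<open>absolutely_continuous\<close>
  concerns measures). A pair \<open>(s, t)\<close> in \<open>I\<close> stands for a compact subinterval of \<open>S\<close>.\<close>

definition abs_cont_on :: "real set \<Rightarrow> (real \<Rightarrow> 'a::real_normed_vector) \<Rightarrow> bool" where
  "abs_cont_on S f \<longleftrightarrow>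
     (\<forall>\<epsilon>>0. \<exists>\<delta>>0. \<forall>I. finite I \<and> (\<forall>(s, t)\<in>I. s < t \<and> {s..t} \<subseteq> S) \<and>
        disjoint_family_on (\<lambda>(s, t). {s<..<t}) I \<and> (\<Sum>(s, t)\<in>I. t - s) < \<delta> \<longrightarrow>
        (\<Sum>(s, t)\<in>I. norm (f t - f s)) < \<epsilon>)"

text \<open>Functions on the interval \<open>Y = (a, b)\<close> are total functions whose values outside
  \<open>Y\<close> are irrelevant. A finite partition of \<open>Y\<close> is given by the finite set \<open>P\<close> of its
  points. Requiring a property on every open interval contained in \<open>Y - P\<close> is the same as
  requiring it on the finitely many maximal ones, because both properties below are inherited
  by subintervals.\<close>

definition Step :: "real \<Rightarrow> real \<Rightarrow> (real \<Rightarrow> complex) set" where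
  "Step a b = {f. \<exists>P. finite P \<and>
     (\<forall>c d. c < d \<and> {c<..<d} \<subseteq> {a<..<b} - P \<longrightarrow> f constant_on {c<..<d})}"

definition Cpw :: "real \<Rightarrow> real \<Rightarrow> (real \<Rightarrow> complex) set" where
  "Cpw a b = {f. \<exists>P. finite P \<and>
     (\<forall>c d. c < d \<and> {c<..<d} \<subseteq> {a<..<b} - P \<longrightarrow> abs_cont_on {c<..<d} f)}"

text \<open>Closure in the essential supremum norm; membership, like the lower bound in \<open>Reg_plus\<close>,
  depends only on the almost-everywhere class of \<open>f\<close>. For complex \<open>f\<close>, the inequality
  \<open>f > \<epsilon>\<close> includes that \<open>f\<close> is real.\<close>

definition Reg :: "real \<Rightarrow> real \<Rightarrow> (real \<Rightarrow> complex) set" where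
  "Reg a b = {f. \<forall>\<delta>>0. \<exists>s\<in>Step a b. AE x\<in>{a<..<b} in lborel. norm (f x - s x) \<le> \<delta>}"

definition Reg_plus :: "real \<Rightarrow> real \<Rightarrow> (real \<Rightarrow> complex) set" where
  "Reg_plus a b = {f \<in> Reg a b.
     \<exists>\<epsilon>>0. AE x\<in>{a<..<b} in lborel. f x \<in> \<real> \<and> Re (f x) > \<epsilon>}"

definition Cpw_plus :: "real \<Rightarrow> real \<Rightarrow> (real \<Rightarrow> complex) set" where
  "Cpw_plus a b = Cpw a b \<inter> Reg_plus a b"

definition no_removable_discontinuities :: "real \<Rightarrow> real \<Rightarrow> (real \<Rightarrow> complex) \<Rightarrow> bool" where
  "no_removable_discontinuities a b f \<longleftrightarrow>
     (\<forall>x\<in>{a<..<b}. \<forall>l. (f \<longlongrightarrow> l) (at x) \<longrightarrow> f x = l)"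

text \<open>In the following, \<open>u'\<close> is an argument: the derivative of \<open>u\<close> exists only almost
  everywhere, and \<open>u'\<close> is a representative of it. Existence of the one-sided limits of \<open>u\<^sup>l\<close>
  and \<open>u\<^sup>r\<close> is required of this representative; the limits do not depend on which one is
  chosen, since two representatives agree on a set dense in \<open>(a, b)\<close>.\<close>

definition left_part :: "real \<Rightarrow> (real \<Rightarrow> complex) \<Rightarrow> (real \<Rightarrow> complex) \<Rightarrow> real \<Rightarrow> complex" where
  "left_part \<omega> u u' x = 1/2 * (u x - 1 / (\<i> * of_real \<omega>) * u' x)"

definition right_part :: "real \<Rightarrow> (real \<Rightarrow> complex) \<Rightarrow> (real \<Rightarrow> complex) \<Rightarrow> real \<Rightarrow> complex" where
  "right_part \<omega> u u' x = 1/2 * (u x + 1 / (\<i> * of_real \<omega>) * u' x)"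

text \<open>\<open>w\<close> is the absolutely continuous representative of \<open>\<eta> u'\<close>.\<close>

definition wave_solution ::
  "real \<Rightarrow> real \<Rightarrow> (real \<Rightarrow> complex) \<Rightarrow> real \<Rightarrow> (real \<Rightarrow> complex) \<Rightarrow> (real \<Rightarrow> complex) \<Rightarrow> bool" where
  "wave_solution a b \<eta> \<omega> u u' \<longleftrightarrow>
     abs_cont_on {a<..<b} u \<and>
     (AE x\<in>{a<..<b} in lborel. (u has_vector_derivative u' x) (at x)) \<and>
     (\<exists>w. abs_cont_on {a<..<b} w \<and>
        (AE x\<in>{a<..<b} in lborel. w x = \<eta> x * u' x) \<and>
        (AE x\<in>{a<..<b} in lborel. \<exists>w'. (w has_vector_derivative w') (at x) \<and>
           w' + of_real (\<omega>\<^sup>2) * \<eta> x * u x = 0))"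

definition scattering_solution ::
  "real \<Rightarrow> real \<Rightarrow> (real \<Rightarrow> complex) \<Rightarrow> real \<Rightarrow> complex \<Rightarrow>
   (real \<Rightarrow> complex) \<Rightarrow> (real \<Rightarrow> complex) \<Rightarrow> bool" where
  "scattering_solution a b \<eta> \<omega> \<xi> u u' \<longleftrightarrow>
     wave_solution a b \<eta> \<omega> u u' \<and>
     (right_part \<omega> u u' \<longlongrightarrow> 1) (at_right a) \<and>
     (\<exists>p. (right_part \<omega> u u' \<longlongrightarrow> p) (at_left b) \<and>
          (left_part \<omega> u u' \<longlongrightarrow> \<xi> * p) (at_left b))"

text \<open>The description operator is applied to the value \<open>u\<^sup>l(a+)\<close> rather than to the solution,
  because a solution is determined only on \<open>(a, b)\<close>, and \<open>u'\<close> only almost everywhere there.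
  Only the values of \<open>\<eta>\<close> on \<open>(a, b)\<close> matter, so for \<open>(c, d) \<subseteq> (a, b)\<close> the coefficient of
  the restriction of \<open>\<eta>\<close> to \<open>(c, d)\<close> is \<open>reflection_coeff c d \<eta>\<close>.\<close>

definition reflection_coeff ::
  "real \<Rightarrow> real \<Rightarrow> (real \<Rightarrow> complex) \<Rightarrow> real \<Rightarrow> complex \<Rightarrow> complex" where
  "reflection_coeff a b \<eta> \<omega> \<xi> =
     (THE z. \<exists>u u'. scattering_solution a b \<eta> \<omega> \<xi> u u' \<and>
        (left_part \<omega> u u' \<longlongrightarrow> z) (at_right a))"

end

theory Submission
  imports Defs
begin

text \<open>With \<open>v = \<eta> u'\<close> the wave equation becomes the first-order system
  \<open>u' = v / \<eta>\<close>, \<open>v' = - \<omega>\<^sup>2 \<eta> u\<close>, in which both components are absolutely continuous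
  across jumps of \<open>\<eta>\<close>. For given data at the right endpoint it has exactly one solution.
  Hence a single solution \<open>(u, v)\<close> on the whole interval with \<open>u\<^sup>r = 1\<close>, \<open>u\<^sup>l = \<xi>\<close> at the
  right end, restricted to the pieces and rescaled, solves the scattering problem on each piece,
  and each reflection coefficient maps the quotient \<open>u\<^sup>l / u\<^sup>r\<close> at the right end of its piece
  to the quotient at the left end. Crossing a jump leaves \<open>u\<close> and \<open>v\<close> unchanged but changes
  the value of \<open>\<eta>\<close>, which acts on the quotient as the disk automorphism. The quotients are
  well defined because the flux \<open>Im (v \<cdot> cnj u) = \<omega> \<eta> (\<bar>u\<^sup>r\<bar>\<^sup>2 - \<bar>u\<^sup>l\<bar>\<^sup>2)\<close> is constant
  and, as \<open>\<bar>\<xi>\<bar> < 1\<close>, of the same sign as \<open>\<omega>\<close>. This works for every \<open>\<omega> \<noteq> 0\<close>.\<close>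

section \<open>Absolutely continuous functions\<close>

lemma abs_cont_onD:
  assumes "abs_cont_on S f" "\<epsilon> > 0"
  obtains \<delta> where "\<delta> > 0"
    "\<And>I. \<lbrakk>finite I; \<And>s t. (s, t) \<in> I \<Longrightarrow> s < t \<and> {s..t} \<subseteq> S;
       disjoint_family_on (\<lambda>(s, t). {s<..<t}) I; (\<Sum>(s, t)\<in>I. t - s) < \<delta>\<rbrakk>
      \<Longrightarrow> (\<Sum>(s, t)\<in>I. norm (f t - f s)) < \<epsilon>"
proof -
  from assms obtain \<delta> where "\<delta> > 0" and d: "\<forall>I. finite I \<and> (\<forall>(s, t)\<in>I. s < t \<and> {s..t} \<subseteq> S) \<and>
        disjoint_family_on (\<lambda>(s, t). {s<..<t}) I \<and> (\<Sum>(s, t)\<in>I. t - s) < \<delta> \<longrightarrow>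
        (\<Sum>(s, t)\<in>I. norm (f t - f s)) < \<epsilon>"
    unfolding abs_cont_on_def by meson
  show thesis
  proof (rule that[OF \<open>\<delta> > 0\<close>])
    fix I :: "(real \<times> real) set"
    assume "finite I" "\<And>s t. (s, t) \<in> I \<Longrightarrow> s < t \<and> {s..t} \<subseteq> S"
       "disjoint_family_on (\<lambda>(s, t). {s<..<t}) I" "(\<Sum>(s, t)\<in>I. t - s) < \<delta>"
    then show "(\<Sum>(s, t)\<in>I. norm (f t - f s)) < \<epsilon>"
      using d by blast
  qed
qed

lemma abs_cont_on_subset:
  assumes f: "abs_cont_on S f" and "T \<subseteq> S"
  shows "abs_cont_on T f"
  unfolding abs_cont_on_def
proof (intro allI impI)
  fix \<epsilon> :: real assume "\<epsilon> > 0"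
  obtain \<delta> where d: "\<delta> > 0"
    "\<And>I. \<lbrakk>finite I; \<And>s t. (s, t) \<in> I \<Longrightarrow> s < t \<and> {s..t} \<subseteq> S;
       disjoint_family_on (\<lambda>(s, t). {s<..<t}) I; (\<Sum>(s, t)\<in>I. t - s) < \<delta>\<rbrakk>
      \<Longrightarrow> (\<Sum>(s, t)\<in>I. norm (f t - f s)) < \<epsilon>"
    using abs_cont_onD[OF f \<open>\<epsilon> > 0\<close>] by metis
  show "\<exists>\<delta>>0. \<forall>I. finite I \<and> (\<forall>(s, t)\<in>I. s < t \<and> {s..t} \<subseteq> T) \<and>
        disjoint_family_on (\<lambda>(s, t). {s<..<t}) I \<and> (\<Sum>(s, t)\<in>I. t - s) < \<delta> \<longrightarrow>
        (\<Sum>(s, t)\<in>I. norm (f t - f s)) < \<epsilon>"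
  proof (intro exI[of _ \<delta>] conjI allI impI)
    fix I :: "(real \<times> real) set"
    assume I: "finite I \<and> (\<forall>(s, t)\<in>I. s < t \<and> {s..t} \<subseteq> T) \<and>
        disjoint_family_on (\<lambda>(s, t). {s<..<t}) I \<and> (\<Sum>(s, t)\<in>I. t - s) < \<delta>"
    then have "s < t \<and> {s..t} \<subseteq> S" if "(s, t) \<in> I" for s t
      using that \<open>T \<subseteq> S\<close> by blast
    with I d(2)[of I] show "(\<Sum>(s, t)\<in>I. norm (f t - f s)) < \<epsilon>" by blast
  qed fact
qed

text \<open>The common source of the closure properties below: when the increments of
  \<open>h\<close> are controlled by those of \<open>f\<close> and \<open>g\<close>, a \<delta> that
  serves both functions serves \<open>h\<close>. Products, sums, linear images and Lipschitz
  functions are instances.\<close>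

lemma abs_cont_on_dominated:
  fixes f :: "real \<Rightarrow> 'a::real_normed_vector" and g :: "real \<Rightarrow> 'b::real_normed_vector"
    and h :: "real \<Rightarrow> 'c::real_normed_vector"
  assumes f: "abs_cont_on S f" and g: "abs_cont_on S g"
    and B: "\<And>s t. s \<in> S \<Longrightarrow> t \<in> S \<Longrightarrow> norm (h t - h s) \<le> B * (norm (f t - f s) + norm (g t - g s))"
  shows "abs_cont_on S h"
  unfolding abs_cont_on_def
proof (intro allI impI)
  fix \<epsilon> :: real assume "\<epsilon> > 0"
  \<comment> \<open>The maximum with 1 makes the constant positive, so that \<epsilon> can be
    divided by it whatever the sign of \<open>B\<close>.\<close>
  define B' where "B' = max B 1"
  have "B' > 0" unfolding B'_def by simp
  then have e: "\<epsilon> / (2 * B') > 0" using \<open>\<epsilon> > 0\<close> by simp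
  obtain d1 where d1: "d1 > 0"
    "\<And>I. \<lbrakk>finite I; \<And>s t. (s, t) \<in> I \<Longrightarrow> s < t \<and> {s..t} \<subseteq> S;
       disjoint_family_on (\<lambda>(s, t). {s<..<t}) I; (\<Sum>(s, t)\<in>I. t - s) < d1\<rbrakk>
      \<Longrightarrow> (\<Sum>(s, t)\<in>I. norm (f t - f s)) < \<epsilon> / (2 * B')"
    using abs_cont_onD[OF f e] by metis
  obtain d2 where d2: "d2 > 0"
    "\<And>I. \<lbrakk>finite I; \<And>s t. (s, t) \<in> I \<Longrightarrow> s < t \<and> {s..t} \<subseteq> S;
       disjoint_family_on (\<lambda>(s, t). {s<..<t}) I; (\<Sum>(s, t)\<in>I. t - s) < d2\<rbrakk>
      \<Longrightarrow> (\<Sum>(s, t)\<in>I. norm (g t - g s)) < \<epsilon> / (2 * B')"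
    using abs_cont_onD[OF g e] by metis
  show "\<exists>\<delta>>0. \<forall>I. finite I \<and> (\<forall>(s, t)\<in>I. s < t \<and> {s..t} \<subseteq> S) \<and>
        disjoint_family_on (\<lambda>(s, t). {s<..<t}) I \<and> (\<Sum>(s, t)\<in>I. t - s) < \<delta> \<longrightarrow>
        (\<Sum>(s, t)\<in>I. norm (h t - h s)) < \<epsilon>"
  proof (intro exI[of _ "min d1 d2"] conjI allI impI)
    show "min d1 d2 > 0" using d1 d2 by simp
    fix I :: "(real \<times> real) set"
    assume I: "finite I \<and> (\<forall>(s, t)\<in>I. s < t \<and> {s..t} \<subseteq> S) \<and>
        disjoint_family_on (\<lambda>(s, t). {s<..<t}) I \<and> (\<Sum>(s, t)\<in>I. t - s) < min d1 d2"
    then have I': "\<And>s t. (s, t) \<in> I \<Longrightarrow> s < t \<and> {s..t} \<subseteq> S" by auto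
    have "(\<Sum>(s, t)\<in>I. norm (h t - h s))
        \<le> (\<Sum>(s, t)\<in>I. B' * (norm (f t - f s) + norm (g t - g s)))"
    proof (rule sum_mono, clarify)
      fix s t assume "(s, t) \<in> I"
      then have "s \<in> S" "t \<in> S" using I' by fastforce+
      then have "norm (h t - h s) \<le> B * (norm (f t - f s) + norm (g t - g s))" using B by blast
      also have "\<dots> \<le> B' * (norm (f t - f s) + norm (g t - g s))"
        unfolding B'_def by (intro mult_right_mono) auto
      finally show "norm (h t - h s) \<le> B' * (norm (f t - f s) + norm (g t - g s))" .
    qed
    also have "\<dots> = B' * ((\<Sum>(s, t)\<in>I. norm (f t - f s)) + (\<Sum>(s, t)\<in>I. norm (g t - g s)))"
      by (simp add: case_prod_beta sum_distrib_left sum.distrib distrib_left)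
    also have "\<dots> < B' * (\<epsilon> / (2 * B') + \<epsilon> / (2 * B'))"
      using \<open>B' > 0\<close> d1(2)[of I] d2(2)[of I] I I' by (intro mult_strict_left_mono add_strict_mono) auto
    also have "\<dots> = \<epsilon>" using \<open>B' > 0\<close> by (simp add: field_simps)
    finally show "(\<Sum>(s, t)\<in>I. norm (h t - h s)) < \<epsilon>" .
  qed
qed

lemma abs_cont_on_id: "abs_cont_on S (\<lambda>x::real. x)"
  unfolding abs_cont_on_def
proof (intro allI impI)
  fix \<epsilon> :: real assume "\<epsilon> > 0"
  have "(\<Sum>(s, t)\<in>I. norm (t - s)) = (\<Sum>(s, t)\<in>I. t - s)"
    if "\<forall>(s, t)\<in>I. s < t \<and> {s..t} \<subseteq> S" for I
    using that by (intro sum.cong) auto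
  then show "\<exists>\<delta>>0. \<forall>I. finite I \<and> (\<forall>(s, t)\<in>I. s < t \<and> {s..t} \<subseteq> S) \<and>
        disjoint_family_on (\<lambda>(s, t). {s<..<t}) I \<and> (\<Sum>(s, t)\<in>I. t - s) < \<delta> \<longrightarrow>
        (\<Sum>(s, t)\<in>I. norm (t - s)) < \<epsilon>"
    using \<open>\<epsilon> > 0\<close> by (intro exI[of _ \<epsilon>]) auto
qed

lemma abs_cont_on_Lipschitz:
  assumes "\<And>s t. s \<in> S \<Longrightarrow> t \<in> S \<Longrightarrow> norm (h t - h s) \<le> B * \<bar>t - s\<bar>"
  shows "abs_cont_on S h"
\<comment> \<open>The identity fills both slots of the domination bound, so its increment is counted
  twice; hence half of \<open>B\<close>.\<close>
proof (rule abs_cont_on_dominated[OF abs_cont_on_id abs_cont_on_id, of _ _ "B / 2"])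
  fix s t assume "s \<in> S" "t \<in> S"
  then show "norm (h t - h s) \<le> B / 2 * (norm (t - s) + norm (t - s))"
    using assms[of s t] by simp
qed

lemma abs_cont_on_mult:
  fixes f g :: "real \<Rightarrow> 'a::real_normed_algebra"
  assumes f: "abs_cont_on S f" and g: "abs_cont_on S g"
    and "bounded (f ` S)" "bounded (g ` S)"
  shows "abs_cont_on S (\<lambda>x. f x * g x)"
proof -
  obtain B where B: "\<And>x. x \<in> S \<Longrightarrow> norm (f x) \<le> B" using assms(3) by (auto simp: bounded_iff)
  obtain C where C: "\<And>x. x \<in> S \<Longrightarrow> norm (g x) \<le> C" using assms(4) by (auto simp: bounded_iff)
  show ?thesis
  proof (rule abs_cont_on_dominated[OF f g, of _ "max B C"])
    fix s t assume st: "s \<in> S" "t \<in> S"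
    have "f t * g t - f s * g s = (f t - f s) * g t + f s * (g t - g s)"
      by (simp add: algebra_simps)
    then have "norm (f t * g t - f s * g s) \<le> norm ((f t - f s) * g t) + norm (f s * (g t - g s))"
      by (metis norm_triangle_ineq)
    also have "\<dots> \<le> norm (f t - f s) * norm (g t) + norm (f s) * norm (g t - g s)"
      by (intro add_mono norm_mult_ineq)
    also have "\<dots> \<le> norm (f t - f s) * max B C + max B C * norm (g t - g s)"
      using B[OF st(1)] C[OF st(2)] by (intro add_mono mult_left_mono mult_right_mono) auto
    finally show "norm (f t * g t - f s * g s) \<le> max B C * (norm (f t - f s) + norm (g t - g s))"
      by (simp add: algebra_simps)
  qed
qed

lemma abs_cont_on_bounded_linear:
  assumes "abs_cont_on S f" "bounded_linear T"
  shows "abs_cont_on S (\<lambda>x. T (f x))"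
proof -
  interpret bounded_linear T by fact
  obtain B where B: "\<And>x. norm (T x) \<le> norm x * B" using bounded by blast
  show ?thesis
  proof (rule abs_cont_on_dominated[OF assms(1) assms(1), of _ "B / 2"])
    fix s t
    show "norm (T (f t) - T (f s)) \<le> B / 2 * (norm (f t - f s) + norm (f t - f s))"
      using B[of "f t - f s"] by (simp add: diff mult.commute)
  qed
qed

lemma abs_cont_on_diff:
  assumes "abs_cont_on S f" "abs_cont_on S g"
  shows "abs_cont_on S (\<lambda>x. f x - g x)"
proof (rule abs_cont_on_dominated[OF assms, of _ 1])
  fix s t
  have "f t - g t - (f s - g s) = (f t - f s) - (g t - g s)" by simp
  then show "norm (f t - g t - (f s - g s)) \<le> 1 * (norm (f t - f s) + norm (g t - g s))"
    by (metis mult_1 norm_triangle_ineq4)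
qed

lemma abs_cont_on_add:
  assumes "abs_cont_on S f" "abs_cont_on S g"
  shows "abs_cont_on S (\<lambda>x. f x + g x)"
  by (rule abs_cont_on_dominated[OF assms, of _ 1]) (simp add: add_diff_add norm_triangle_ineq)

text \<open>A single interval is an admissible family in the definition, and
  \<open>is_interval\<close> puts all of \<open>{s..t}\<close> inside \<open>S\<close> once the
  endpoints are there.\<close>

lemma abs_cont_on_imp_uniformly_continuous_on:
  assumes f: "abs_cont_on S f" and S: "is_interval S"
  shows "uniformly_continuous_on S f"
  unfolding uniformly_continuous_on_def
proof (intro allI impI)
  fix \<epsilon> :: real assume "\<epsilon> > 0"
  obtain \<delta> where d: "\<delta> > 0"
    "\<And>I. \<lbrakk>finite I; \<And>s t. (s, t) \<in> I \<Longrightarrow> s < t \<and> {s..t} \<subseteq> S;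
       disjoint_family_on (\<lambda>(s, t). {s<..<t}) I; (\<Sum>(s, t)\<in>I. t - s) < \<delta>\<rbrakk>
      \<Longrightarrow> (\<Sum>(s, t)\<in>I. norm (f t - f s)) < \<epsilon>"
    using abs_cont_onD[OF f \<open>\<epsilon> > 0\<close>] by metis
  have less: "norm (f t - f s) < \<epsilon>" if "s \<in> S" "t \<in> S" "s < t" "t - s < \<delta>" for s t
  proof -
    have "{s..t} \<subseteq> S"
      using S that by (meson atLeastAtMost_iff mem_is_interval_1_I subsetI)
    then show ?thesis using d(2)[of "{(s, t)}"] that by (auto simp: disjoint_family_on_def)
  qed
  show "\<exists>d>0. \<forall>x\<in>S. \<forall>x'\<in>S. dist x' x < d \<longrightarrow> dist (f x') (f x) < \<epsilon>"
  proof (intro exI[of _ \<delta>] conjI ballI impI)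
    fix x x' assume "x \<in> S" "x' \<in> S" "dist x' x < \<delta>"
    then show "dist (f x') (f x) < \<epsilon>"
      using less[of x x'] less[of x' x] \<open>\<epsilon> > 0\<close>
      by (cases x x' rule: linorder_cases) (auto simp: dist_norm norm_minus_commute)
  qed (use d in simp)
qed

section \<open>Monotonicity from the sign of the derivative almost everywhere\<close>

text \<open>In a fine tagged division, the intervals tagged at points of differentiability decrease
  \<open>f\<close> by at most \<open>\<epsilon>\<close> per unit length. The others are tagged in a null set and have small total
  length, so absolute continuity bounds the change of \<open>f\<close> over them.\<close>

lemma abs_cont_on_nonneg_deriv_imp_le:
  fixes f :: "real \<Rightarrow> real"
  assumes "a \<le> b" and f: "abs_cont_on {a..b} f"
    and deriv: "AE x\<in>{a<..<b} in lborel. \<exists>D\<ge>0. (f has_real_derivative D) (at x)"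
  shows "f a \<le> f b"
proof (rule field_le_epsilon)
  fix e :: real assume "e > 0"
  \<comment> \<open>Intervals with good tags may lose \<epsilon> per unit length and the others
    \<epsilon> in total, so this choice makes the losses add up to \<open>e\<close>. The 1 in the
    denominator covers \<open>a = b\<close>.\<close>
  define \<epsilon> where "\<epsilon> = e / (b - a + 1)"
  have "\<epsilon> > 0" and "\<epsilon> * (b - a + 1) = e"
    using \<open>e > 0\<close> \<open>a \<le> b\<close> by (auto simp: \<epsilon>_def)
  then have e: "\<epsilon> * (b - a) + \<epsilon> = e" by (simp add: algebra_simps)
  define G where "G = {x\<in>{a<..<b}. \<exists>D\<ge>0. (f has_real_derivative D) (at x)}"
  define N where "N = {a..b} - G"
  have "AE x in lborel. x \<notin> N"
    using deriv AE_lborel_singleton[of a] AE_lborel_singleton[of b]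
    by eventually_elim (auto simp: N_def G_def)
  then obtain N' where "{x \<in> space lborel. \<not> x \<notin> N} \<subseteq> N'" "N' \<in> null_sets lborel"
    unfolding eventually_ae_filter by blast
  then have "N \<subseteq> N'" "N' \<in> null_sets lborel" by auto
  then have N: "N \<in> null_sets lebesgue"
    by (metis completion.complete2 null_sets_completionI)
  obtain \<delta> where d: "\<delta> > 0"
    "\<And>I. \<lbrakk>finite I; \<And>s t. (s, t) \<in> I \<Longrightarrow> s < t \<and> {s..t} \<subseteq> {a..b};
       disjoint_family_on (\<lambda>(s, t). {s<..<t}) I; (\<Sum>(s, t)\<in>I. t - s) < \<delta>\<rbrakk>
      \<Longrightarrow> (\<Sum>(s, t)\<in>I. norm (f t - f s)) < \<epsilon>"
    using abs_cont_onD[OF f \<open>\<epsilon> > 0\<close>] by metis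
  \<comment> \<open>Outer regularity encloses the null set of bad tags in an open set of measure
    below the \<delta> of absolute continuity.\<close>
  obtain U where U: "open U" "N \<subseteq> U" "(U - N) \<in> lmeasurable" "emeasure lebesgue (U - N) < ennreal \<delta>"
    using sets_lebesgue_outer_open[of N \<delta>] N \<open>\<delta> > 0\<close> by (metis null_setsD2)
  have eU: "emeasure lebesgue U < ennreal \<delta>"
    using U(4) emeasure_Diff_null_set[OF N, of U] U(1) by simp
  then have "U \<in> lmeasurable"
    using U(1) by (auto simp: fmeasurable_def intro: less_trans[OF _ ennreal_less_top])
  moreover from this have "measure lebesgue U < \<delta>"
    using eU emeasure_eq_measure2[of U lebesgue] by (simp add: ennreal_less_iff)
  ultimately have mU: "measure lebesgue U < \<delta>" "U \<in> lmeasurable" by auto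
  \<comment> \<open>The straddle estimate: the tag lies between \<open>s\<close> and
    \<open>t\<close>, so the errors on its two sides add up to \<epsilon> times
    \<open>t - s\<close>, and the linear term has the favourable sign because \<open>D\<close> is
    nonnegative.\<close>
  have "\<exists>d>0. \<forall>s t. s \<le> x \<and> x \<le> t \<and> {s..t} \<subseteq> ball x d \<longrightarrow> f t - f s \<ge> - \<epsilon> * (t - s)"
    if x: "x \<in> G" for x
  proof -
    obtain D where "D \<ge> 0" and D: "(f has_real_derivative D) (at x)" using x by (auto simp: G_def)
    from D obtain d where "d > 0" and d: "\<And>y. norm (y - x) < d \<Longrightarrow> norm (f y - f x - D * (y - x)) \<le> \<epsilon> * norm (y - x)"
      unfolding has_field_derivative_def has_derivative_at_alt using \<open>\<epsilon> > 0\<close> by auto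
    show ?thesis
    proof (intro exI[of _ d] conjI allI impI)
      fix s t assume st: "s \<le> x \<and> x \<le> t \<and> {s..t} \<subseteq> ball x d"
      then have "s \<in> {s..t}" "t \<in> {s..t}" by auto
      then have "s \<in> ball x d" "t \<in> ball x d" using st by blast+
      then have "norm (s - x) < d" "norm (t - x) < d" by (auto simp: dist_real_def)
      from d[OF this(1)] d[OF this(2)] st
      have "f t - f x - D * (t - x) \<ge> - \<epsilon> * (t - x)" "f s - f x - D * (s - x) \<le> \<epsilon> * (x - s)"
        by (auto simp: abs_le_iff abs_if split: if_splits)
      moreover have "D * (t - x) \<ge> 0" "D * (x - s) \<ge> 0" using \<open>D \<ge> 0\<close> st by auto
      ultimately show "f t - f s \<ge> - \<epsilon> * (t - s)" by (simp add: algebra_simps)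
    qed fact
  qed
  then obtain d' where d': "\<And>x. x \<in> G \<Longrightarrow> d' x > 0"
    "\<And>x s t. \<lbrakk>x \<in> G; s \<le> x; x \<le> t; {s..t} \<subseteq> ball x (d' x)\<rbrakk> \<Longrightarrow> f t - f s \<ge> - \<epsilon> * (t - s)"
    by metis
  \<comment> \<open>Intervals tagged in \<open>N\<close> are forced into \<open>U\<close>. The last
    case concerns only points outside \<open>{a..b}\<close>, which are never tags.\<close>
  define \<gamma> where "\<gamma> x = (if x \<in> G then ball x (d' x) else if x \<in> N then U else UNIV)" for x
  have "gauge \<gamma>" unfolding gauge_def \<gamma>_def using d' U by auto
  then obtain p where p: "p tagged_division_of {a..b}" "\<gamma> fine p"
    using fine_division_exists_real by blast
  note pD = tagged_division_ofD[OF p(1)]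
  have K: "\<exists>s t. K = {s..t} \<and> s \<le> x \<and> x \<le> t \<and> Inf K = s \<and> Sup K = t \<and> {s..t} \<subseteq> {a..b} \<and> {s..t} \<subseteq> \<gamma> x"
    if xK: "(x, K) \<in> p" for x K
  proof -
    obtain s t where st: "K = cbox s t" using pD(4) xK by blast
    then have "x \<in> {s..t}" "{s..t} \<subseteq> {a..b}" using pD(2,3)[OF xK] by auto
    moreover have "K \<subseteq> \<gamma> x" using p(2) xK by (auto simp: fine_def)
    ultimately show ?thesis using st by (auto intro!: exI[of _ s] exI[of _ t])
  qed
  \<comment> \<open>\<open>p3\<close> collects the degenerate intervals with bad tags. They
    contribute nothing and would violate \<open>s < t\<close> in the definition of absolute
    continuity, so only \<open>p2\<close> is fed into it.\<close>
  define p1 where "p1 = {(x, K)\<in>p. x \<in> G}"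
  define p2 where "p2 = {(x, K)\<in>p. x \<notin> G \<and> Inf K < Sup K}"
  define p3 where "p3 = {(x, K)\<in>p. x \<notin> G \<and> \<not> Inf K < Sup K}"
  have fin: "finite p1" "finite p2" "finite p3"
    using pD(1) by (auto simp: p1_def p2_def p3_def intro: finite_subset[of _ p])
  have pU: "p = p1 \<union> p2 \<union> p3" "(p1 \<union> p2) \<inter> p3 = {}" "p1 \<inter> p2 = {}"
    by (auto simp: p1_def p2_def p3_def)
  have split: "sum h p = sum h p1 + sum h p2 + sum h p3" for h :: "real \<times> real set \<Rightarrow> real"
    unfolding pU(1) using pU fin by (subst sum.union_disjoint; simp add: sum.union_disjoint)+
  let ?F = "\<lambda>(x::real, K). f (Sup K) - f (Inf K)"
  let ?L = "\<lambda>(x::real, K). Sup K - Inf K :: real"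
  have F: "sum ?F p = f b - f a" and L: "sum ?L p = b - a"
    using additive_tagged_division_1[OF \<open>a \<le> b\<close> p(1), of f]
      additive_tagged_division_1[OF \<open>a \<le> b\<close> p(1), of "\<lambda>x. x"] by auto
  have z3: "?F z = 0 \<and> ?L z = 0" if "z \<in> p3" for z
    using that K unfolding p3_def by (fastforce simp: p3_def)
  then have F3: "sum ?F p3 = 0" by (intro sum.neutral) auto
  have Lpos: "?L z \<ge> 0" if z: "z \<in> p" for z
  proof -
    obtain x K where "z = (x, K)" "(x, K) \<in> p" using z by (cases z) auto
    then show ?thesis using K[of x K] by auto
  qed
  have "sum ?F p1 \<ge> (\<Sum>z\<in>p1. - \<epsilon> * ?L z)"
  proof (rule sum_mono)
    fix z assume z: "z \<in> p1"
    then obtain x K where xK: "z = (x, K)" "(x, K) \<in> p" "x \<in> G" by (auto simp: p1_def)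
    with K[OF this(2)] d'(2)[of x] show "- \<epsilon> * ?L z \<le> ?F z" by (auto simp: \<gamma>_def)
  qed
  also have "(\<Sum>z\<in>p1. - \<epsilon> * ?L z) = - \<epsilon> * sum ?L p1" by (simp only: sum_distrib_left)
  finally have F1: "sum ?F p1 \<ge> - \<epsilon> * sum ?L p1" .
  have "sum ?L p1 \<le> sum ?L p" using pU(1) pD(1) Lpos by (intro sum_mono2) auto
  with F1 L \<open>\<epsilon> > 0\<close> have F1: "sum ?F p1 \<ge> - \<epsilon> * (b - a)"
    by (smt (verit, best) mult_left_mono mult_minus_left)
  define J where "J = (\<lambda>(x::real, K). (Inf K, Sup K)) ` p2"
  have int: "interior K1 \<inter> interior K2 = {}" if "(x1, K1) \<in> p2" "(x2, K2) \<in> p2" "(x1, K1) \<noteq> (x2, K2)" for x1 K1 x2 K2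
    using pD(5)[of x1 K1 x2 K2] that by (simp add: p2_def)
  have K2: "interior K = {Inf K<..<Sup K} \<and> K = {Inf K..Sup K} \<and> Inf K < Sup K \<and> K \<subseteq> {a..b} \<and> K \<subseteq> U"
    if xK: "(x, K) \<in> p2" for x K
  proof -
    have p: "(x, K) \<in> p" "x \<notin> G" "Inf K < Sup K" using xK by (auto simp: p2_def)
    obtain s t where st: "K = {s..t}" "s \<le> x" "x \<le> t" "Inf K = s" "Sup K = t" "{s..t} \<subseteq> {a..b}"
      "{s..t} \<subseteq> \<gamma> x"
      using K[OF p(1)] by blast
    then have "x \<in> {a..b}" by (meson atLeastAtMost_iff subsetD)
    then have "\<gamma> x = U" using p by (simp add: \<gamma>_def N_def)
    then show ?thesis using st p by simp
  qed
  have disj: "z1 = z2" if "z1 \<in> p2" "z2 \<in> p2" "{Inf (snd z1)<..<Sup (snd z1)} \<inter> {Inf (snd z2)<..<Sup (snd z2)} \<noteq> {}" for z1 z2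
    using int[of "fst z1" "snd z1" "fst z2" "snd z2"] K2[of "fst z1" "snd z1"] K2[of "fst z2" "snd z2"] that
    by (metis prod.collapse)
  \<comment> \<open>Two different members of \<open>p2\<close> with equal endpoints would have
    overlapping nonempty interiors, so no interval is lost when the tags are forgotten.\<close>
  have inj: "inj_on (\<lambda>(x::real, K). (Inf K, Sup K :: real)) p2"
  proof (rule inj_onI)
    fix z1 z2 assume z: "z1 \<in> p2" "z2 \<in> p2"
      "(\<lambda>(x::real, K). (Inf K, Sup K :: real)) z1 = (\<lambda>(x, K). (Inf K, Sup K)) z2"
    moreover have "Inf (snd z1) < Sup (snd z1)" using K2[of "fst z1" "snd z1"] z by simp
    ultimately show "z1 = z2" by (intro disj) (auto simp: case_prod_beta)
  qed
  have finJ: "finite J" using fin by (simp add: J_def)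
  have J: "s < t \<and> {s..t} \<subseteq> {a..b} \<and> {s..t} \<subseteq> U" if st: "(s, t) \<in> J" for s t
  proof -
    obtain x K where "(x, K) \<in> p2" "s = Inf K" "t = Sup K" using st by (auto simp: J_def)
    then show ?thesis using K2[of x K] by simp
  qed
  then have J1: "\<And>s t. (s, t) \<in> J \<Longrightarrow> s < t \<and> {s..t} \<subseteq> {a..b}"
    and JU: "\<And>s t. (s, t) \<in> J \<Longrightarrow> {s..t} \<subseteq> U" by blast+
  have J2: "disjoint_family_on (\<lambda>(s, t). {s<..<t}) J"
    unfolding disjoint_family_on_def
  proof (intro ballI impI)
    fix i j assume ij: "i \<in> J" "j \<in> J" "i \<noteq> j"
    then obtain z1 z2 where "z1 \<in> p2" "z2 \<in> p2" "i = (Inf (snd z1), Sup (snd z1))" "j = (Inf (snd z2), Sup (snd z2))"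
      by (auto simp: J_def case_prod_beta)
    then show "(case i of (s, t) \<Rightarrow> {s<..<t}) \<inter> (case j of (s, t) \<Rightarrow> {s<..<t}) = {}"
      using disj[of z1 z2] ij by auto
  qed
  \<comment> \<open>The open intervals are disjoint and lie in \<open>U\<close>, so their total
    length stays below \<delta>.\<close>
  have "(\<Sum>(s, t)\<in>J. t - s) = (\<Sum>z\<in>J. measure lebesgue (case z of (s, t) \<Rightarrow> {s<..<t}))"
    using J1 by (intro sum.cong) fastforce+
  also have "\<dots> = measure lebesgue (\<Union>z\<in>J. case z of (s, t) \<Rightarrow> {s<..<t})"
    by (rule measure_finite_Union[symmetric]) (use finJ J2 J1(1) in \<open>auto simp: less_imp_le\<close>)
  also have "\<dots> \<le> measure lebesgue U"
  proof (rule measure_mono_fmeasurable)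
    show "(\<Union>z\<in>J. case z of (s, t) \<Rightarrow> {s<..<t}) \<subseteq> U"
      using JU by (fastforce simp: less_imp_le)
  qed (use mU finJ in auto)
  finally have "(\<Sum>(s, t)\<in>J. norm (f t - f s)) < \<epsilon>"
    using mU J1 J2 finJ by (intro d(2)) auto
  moreover have "(\<Sum>(s, t)\<in>J. norm (f t - f s)) = (\<Sum>z\<in>p2. norm (?F z))"
    unfolding J_def by (subst sum.reindex[OF inj]) (auto simp: case_prod_beta intro!: sum.cong)
  moreover have "norm (sum ?F p2) \<le> (\<Sum>z\<in>p2. norm (?F z))" by (rule norm_sum)
  ultimately have "norm (sum ?F p2) < \<epsilon>" by linarith
  then have "sum ?F p2 > - \<epsilon>" unfolding real_norm_def abs_less_iff by linarith
  with F1 F3 F split[of ?F] have "f b - f a \<ge> - (\<epsilon> * (b - a) + \<epsilon>)" by simp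
  with e show "f a \<le> f b + e" by simp
qed

section \<open>Bounded open intervals: exponential weight, boundedness, limits at the
  endpoints\<close>

lemma abs_cont_on_exp_mult:
  fixes M :: real
  shows "abs_cont_on {a<..<b} (\<lambda>x. exp (M * x))"
proof (rule abs_cont_on_Lipschitz)
  fix s t assume st: "s \<in> {a<..<b}" "t \<in> {a<..<b}"
  have "norm (exp (M * t) - exp (M * s)) \<le> (\<bar>M\<bar> * exp (\<bar>M\<bar> * (\<bar>a\<bar> + \<bar>b\<bar>))) * norm (t - s)"
  proof (rule field_differentiable_bound[of "{a<..<b}" _ "\<lambda>x. M * exp (M * x)"])
    fix z assume z: "z \<in> {a<..<b}"
    show "((\<lambda>x. exp (M * x)) has_field_derivative M * exp (M * z)) (at z within {a<..<b})"
      by (auto intro!: derivative_eq_intros)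
    have "M * z \<le> \<bar>M\<bar> * \<bar>z\<bar>" by (metis abs_ge_self abs_mult)
    also have "\<dots> \<le> \<bar>M\<bar> * (\<bar>a\<bar> + \<bar>b\<bar>)" using z by (intro mult_left_mono) auto
    finally show "norm (M * exp (M * z)) \<le> \<bar>M\<bar> * exp (\<bar>M\<bar> * (\<bar>a\<bar> + \<bar>b\<bar>))"
      by (simp add: abs_mult mult_left_mono)
  qed (use st in auto)
  then show "norm (exp (M * t) - exp (M * s)) \<le> (\<bar>M\<bar> * exp (\<bar>M\<bar> * (\<bar>a\<bar> + \<bar>b\<bar>))) * \<bar>t - s\<bar>"
    by simp
qed

lemma abs_cont_on_interval_bounded:
  fixes f :: "real \<Rightarrow> 'a::{real_normed_vector, heine_borel}"
  assumes "abs_cont_on {a<..<b} f"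
  shows "bounded (f ` {a<..<b})"
proof (rule bounded_uniformly_continuous_image)
  show "uniformly_continuous_on {a<..<b} f"
    by (rule abs_cont_on_imp_uniformly_continuous_on[OF assms]) (auto simp: is_interval_oo)
qed simp

text \<open>A uniformly continuous map into a complete space extends continuously to the closure of
  its domain; the values of the extension at the endpoints are the limits.\<close>

lemma abs_cont_on_tendsto_endpoints:
  fixes f :: "real \<Rightarrow> 'a::{real_normed_vector, complete_space}"
  assumes f: "abs_cont_on {a<..<b} f" and "a < b"
  obtains l m where "(f \<longlongrightarrow> l) (at_right a)" "(f \<longlongrightarrow> m) (at_left b)"
proof -
  have uc: "uniformly_continuous_on {a<..<b} f"
    by (rule abs_cont_on_imp_uniformly_continuous_on[OF f]) (auto simp: is_interval_oo)
  obtain l where "(f \<longlongrightarrow> l) (at a within {a<..<b})"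
    by (rule uniformly_continuous_on_extension_at_closure[OF uc, of a]) (use \<open>a < b\<close> in auto)
  moreover obtain m where "(f \<longlongrightarrow> m) (at b within {a<..<b})"
    by (rule uniformly_continuous_on_extension_at_closure[OF uc, of b]) (use \<open>a < b\<close> in auto)
  moreover have "at a within {a<..<b} = at_right a"
    by (rule at_within_nhd[of _ "{..<b}"]) (use \<open>a < b\<close> in auto)
  moreover have "at b within {a<..<b} = at_left b"
    by (rule at_within_nhd[of _ "{a<..}"]) (use \<open>a < b\<close> in auto)
  ultimately show thesis using that by simp
qed

section \<open>From almost-everywhere statements to one-sided limits\<close>

lemma AE_interval_obtains:
  assumes "AE x\<in>{a<..<b::real} in lborel. P x" "a \<le> c" "c < d" "d \<le> b"
  obtains x where "c < x" "x < d" "P x"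
proof -
  have "\<exists>x. c < x \<and> x < d \<and> P x"
  proof (rule ccontr)
    assume "\<nexists>x. c < x \<and> x < d \<and> P x"
    then have no: "\<And>x. x \<in> {c<..<d} \<Longrightarrow> \<not> P x" by auto
    have "AE x in lborel. x \<notin> {c<..<d}"
      using assms(1) by eventually_elim (use no assms(2,4) in force)
    then have "{c<..<d} \<in> null_sets lborel" by (subst AE_iff_null_sets) auto
    then have "emeasure lborel {c<..<d} = 0" by auto
    then show False using \<open>c < d\<close> by simp
  qed
  then show thesis using that by auto
qed

text \<open>A property valid almost everywhere holds at points arbitrarily close to \<open>c\<close>
  on the right, so the limit cannot leave a closed set. With a singleton for \<open>C\<close> this
  carries an almost-everywhere equation over to a one-sided limit.\<close>

lemma AE_tendsto_at_right_closed:
  fixes f :: "real \<Rightarrow> 'a::topological_space"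
  assumes P: "AE x\<in>{a<..<b} in lborel. f x \<in> C" and C: "closed C"
    and "a \<le> c" "c < b" and f: "(f \<longlongrightarrow> l) (at_right c)"
  shows "l \<in> C"
proof (rule ccontr)
  assume "l \<notin> C"
  then have "\<forall>\<^sub>F x in at_right c. f x \<in> - C" using topological_tendstoD[OF f, of "- C"] C by auto
  then obtain d where "d > c" "\<And>x. c < x \<Longrightarrow> x < d \<Longrightarrow> f x \<notin> C"
    unfolding eventually_at_right_field by auto
  moreover obtain x where "c < x" "x < min d b" "f x \<in> C"
    by (rule AE_interval_obtains[OF P, of c "min d b"]) (use assms \<open>d > c\<close> in auto)
  ultimately show False by auto
qed

lemma AE_tendsto_at_left_closed:
  fixes f :: "real \<Rightarrow> 'a::topological_space"
  assumes P: "AE x\<in>{a<..<b} in lborel. f x \<in> C" and C: "closed C"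
    and "a < c" "c \<le> b" and f: "(f \<longlongrightarrow> l) (at_left c)"
  shows "l \<in> C"
proof (rule ccontr)
  assume "l \<notin> C"
  then have "\<forall>\<^sub>F x in at_left c. f x \<in> - C" using topological_tendstoD[OF f, of "- C"] C by auto
  then obtain d where "d < c" "\<And>x. d < x \<Longrightarrow> x < c \<Longrightarrow> f x \<notin> C"
    unfolding eventually_at_left_field by auto
  moreover obtain x where "max d a < x" "x < c" "f x \<in> C"
    by (rule AE_interval_obtains[OF P, of "max d a" c]) (use assms \<open>d < c\<close> in auto)
  ultimately show False by auto
qed

section \<open>The first-order system\<close>

definition wave_pair ::
  "real \<Rightarrow> real \<Rightarrow> (real \<Rightarrow> complex) \<Rightarrow> real \<Rightarrow> (real \<Rightarrow> complex) \<Rightarrow> (real \<Rightarrow> complex) \<Rightarrow> bool" where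
  "wave_pair a b \<eta> \<omega> u v \<longleftrightarrow> abs_cont_on {a<..<b} u \<and> abs_cont_on {a<..<b} v \<and>
     (AE x\<in>{a<..<b} in lborel. (u has_vector_derivative v x / \<eta> x) (at x) \<and>
        (v has_vector_derivative - (of_real (\<omega>\<^sup>2) * \<eta> x * u x)) (at x))"

text \<open>The lower bound is non-strict so that it survives the passage to one-sided limits of
  \<eta>.\<close>

definition coeff_between :: "real \<Rightarrow> real \<Rightarrow> real \<Rightarrow> real \<Rightarrow> (real \<Rightarrow> complex) \<Rightarrow> bool" where
  "coeff_between \<epsilon> B a b \<eta> \<longleftrightarrow>
     (AE x\<in>{a<..<b} in lborel. \<eta> x \<in> \<real> \<and> \<epsilon> \<le> Re (\<eta> x) \<and> norm (\<eta> x) \<le> B)"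

lemma coeff_between_subinterval:
  assumes "coeff_between \<epsilon> B a b \<eta>" "a \<le> c" "d \<le> b"
  shows "coeff_between \<epsilon> B c d \<eta>"
  using assms unfolding coeff_between_def by (auto elim!: eventually_mono)

lemma wave_pair_subinterval:
  assumes "wave_pair a b \<eta> \<omega> u v" "a \<le> c" "d \<le> b"
  shows "wave_pair c d \<eta> \<omega> u v"
proof -
  have "{c<..<d} \<subseteq> {a<..<b}" using assms by auto
  moreover have "AE x\<in>{c<..<d} in lborel. (u has_vector_derivative v x / \<eta> x) (at x) \<and>
        (v has_vector_derivative - (of_real (\<omega>\<^sup>2) * \<eta> x * u x)) (at x)"
    using assms unfolding wave_pair_def by (auto elim!: eventually_mono)
  ultimately show ?thesis
    using assms(1) unfolding wave_pair_def by (blast intro: abs_cont_on_subset)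
qed

lemma abs_cont_on_mult_left:
  fixes f :: "real \<Rightarrow> 'a::real_normed_algebra"
  shows "abs_cont_on S f \<Longrightarrow> abs_cont_on S (\<lambda>x. c * f x)"
  by (rule abs_cont_on_bounded_linear[OF _ bounded_linear_mult_right])

text \<open>Serves two purposes: with \<open>d = 0\<close> it rescales a solution, and with
  coefficients that cancel the data at the right endpoint it reduces uniqueness to the zero
  solution.\<close>

lemma wave_pair_linear_combination:
  assumes 1: "wave_pair a b \<eta> \<omega> u1 v1" and 2: "wave_pair a b \<eta> \<omega> u2 v2"
  shows "wave_pair a b \<eta> \<omega> (\<lambda>x. c * u1 x - d * u2 x) (\<lambda>x. c * v1 x - d * v2 x)"
  unfolding wave_pair_def
proof (intro conjI)
  have "AE x\<in>{a<..<b} in lborel. ((u1 has_vector_derivative v1 x / \<eta> x) (at x) \<and>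
        (v1 has_vector_derivative - (of_real (\<omega>\<^sup>2) * \<eta> x * u1 x)) (at x))"
     "AE x\<in>{a<..<b} in lborel. ((u2 has_vector_derivative v2 x / \<eta> x) (at x) \<and>
        (v2 has_vector_derivative - (of_real (\<omega>\<^sup>2) * \<eta> x * u2 x)) (at x))"
    using 1 2 unfolding wave_pair_def by auto
  then show "AE x\<in>{a<..<b} in lborel.
       ((\<lambda>x. c * u1 x - d * u2 x) has_vector_derivative (c * v1 x - d * v2 x) / \<eta> x) (at x) \<and>
       ((\<lambda>x. c * v1 x - d * v2 x) has_vector_derivative
          - (of_real (\<omega>\<^sup>2) * \<eta> x * (c * u1 x - d * u2 x))) (at x)"
  proof (eventually_elim, intro impI conjI)
    fix x assume h: "x \<in> {a<..<b} \<longrightarrow> ((u1 has_vector_derivative v1 x / \<eta> x) (at x) \<and>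
        (v1 has_vector_derivative - (of_real (\<omega>\<^sup>2) * \<eta> x * u1 x)) (at x))"
     "x \<in> {a<..<b} \<longrightarrow> ((u2 has_vector_derivative v2 x / \<eta> x) (at x) \<and>
        (v2 has_vector_derivative - (of_real (\<omega>\<^sup>2) * \<eta> x * u2 x)) (at x))" "x \<in> {a<..<b}"
    then have d: "(u1 has_vector_derivative v1 x / \<eta> x) (at x)"
      "(u2 has_vector_derivative v2 x / \<eta> x) (at x)"
      "(v1 has_vector_derivative - (of_real (\<omega>\<^sup>2) * \<eta> x * u1 x)) (at x)"
      "(v2 has_vector_derivative - (of_real (\<omega>\<^sup>2) * \<eta> x * u2 x)) (at x)"
      by auto
    have "((\<lambda>x. c * u1 x - d * u2 x) has_vector_derivative c * (v1 x / \<eta> x) - d * (v2 x / \<eta> x)) (at x)"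
      "((\<lambda>x. c * v1 x - d * v2 x) has_vector_derivative
          c * (- (of_real (\<omega>\<^sup>2) * \<eta> x * u1 x)) - d * (- (of_real (\<omega>\<^sup>2) * \<eta> x * u2 x))) (at x)"
      by (intro has_vector_derivative_diff has_vector_derivative_mult_right d)+
    then show "((\<lambda>x. c * u1 x - d * u2 x) has_vector_derivative (c * v1 x - d * v2 x) / \<eta> x) (at x)"
       "((\<lambda>x. c * v1 x - d * v2 x) has_vector_derivative
          - (of_real (\<omega>\<^sup>2) * \<eta> x * (c * u1 x - d * u2 x))) (at x)"
      by (simp_all add: diff_divide_distrib algebra_simps)
  qed
qed (use 1 2 in \<open>auto simp: wave_pair_def intro!: abs_cont_on_diff abs_cont_on_mult_left\<close>)

section \<open>Conserved flux and uniqueness for data at the right endpoint\<close>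

lemma abs_cont_on_cmult_cnj:
  assumes "abs_cont_on {a<..<b} f" "abs_cont_on {a<..<b} g"
  shows "abs_cont_on {a<..<b} (\<lambda>x. f x * cnj (g x))"
proof (rule abs_cont_on_mult[OF assms(1)])
  show g: "abs_cont_on {a<..<b} (\<lambda>x. cnj (g x))"
    by (rule abs_cont_on_bounded_linear[OF assms(2) bounded_linear_cnj])
  show "bounded (f ` {a<..<b})" "bounded ((\<lambda>x. cnj (g x)) ` {a<..<b})"
    by (intro abs_cont_on_interval_bounded assms g)+
qed

text \<open>The derivative of \<open>v * cnj u\<close> is a multiple of the squared modulus of
  \<open>v\<close> by the inverse of \<eta>, minus a multiple of that of \<open>u\<close> by \<eta>.
  Both are real because \<eta> is, so the imaginary part has derivative zero almost everywhere, and
  absolute continuity makes it constant.\<close>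

lemma wave_pair_flux_constant:
  assumes w: "wave_pair a b \<eta> \<omega> u v" and \<eta>: "coeff_between \<epsilon> B a b \<eta>"
    and st: "s \<in> {a<..<b}" "t \<in> {a<..<b}"
  shows "Im (v s * cnj (u s)) = Im (v t * cnj (u t))"
proof -
  let ?f = "\<lambda>x. Im (v x * cnj (u x))"
  have ac: "abs_cont_on {a<..<b} ?f"
    using w unfolding wave_pair_def
    by (intro abs_cont_on_bounded_linear[OF _ bounded_linear_Im] abs_cont_on_cmult_cnj) auto
  have "AE x\<in>{a<..<b} in lborel. (u has_vector_derivative v x / \<eta> x) (at x) \<and>
        (v has_vector_derivative - (of_real (\<omega>\<^sup>2) * \<eta> x * u x)) (at x)"
    using w unfolding wave_pair_def by auto
  with \<eta> have deriv: "AE x\<in>{a<..<b} in lborel. (?f has_real_derivative 0) (at x)"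
    unfolding coeff_between_def
  proof (eventually_elim, intro impI)
    fix x assume "x \<in> {a<..<b} \<longrightarrow> (u has_vector_derivative v x / \<eta> x) (at x) \<and>
        (v has_vector_derivative - (of_real (\<omega>\<^sup>2) * \<eta> x * u x)) (at x)"
      "x \<in> {a<..<b} \<longrightarrow> \<eta> x \<in> \<real> \<and> \<epsilon> \<le> Re (\<eta> x) \<and> norm (\<eta> x) \<le> B" "x \<in> {a<..<b}"
    then have u: "(u has_vector_derivative v x / \<eta> x) (at x)"
      and v: "(v has_vector_derivative - (of_real (\<omega>\<^sup>2) * \<eta> x * u x)) (at x)" and "\<eta> x \<in> \<real>" by auto
    then obtain k where k: "\<eta> x = of_real k" by (auto elim: Reals_cases)
    have "((\<lambda>x. v x * cnj (u x)) has_vector_derivative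
       v x * cnj (v x / \<eta> x) + - (of_real (\<omega>\<^sup>2) * \<eta> x * u x) * cnj (u x)) (at x)"
      by (intro has_vector_derivative_mult v has_vector_derivative_cnj u)
    then have "(?f has_vector_derivative
       Im (v x * cnj (v x / \<eta> x) + - (of_real (\<omega>\<^sup>2) * \<eta> x * u x) * cnj (u x))) (at x)"
      by (rule bounded_linear.has_vector_derivative[OF bounded_linear_Im])
    moreover have "Im (v x * cnj (v x / \<eta> x) + - (of_real (\<omega>\<^sup>2) * \<eta> x * u x) * cnj (u x)) = 0"
      by (simp add: k algebra_simps)
    ultimately show "(?f has_real_derivative 0) (at x)"
      by (simp add: has_real_derivative_iff_has_vector_derivative)
  qed
  have le: "?f s = ?f t" if "s \<le> t" "s \<in> {a<..<b}" "t \<in> {a<..<b}" for s t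
  proof (rule antisym)
    have ac': "abs_cont_on {s..t} ?f" by (rule abs_cont_on_subset[OF ac]) (use that in auto)
    have d: "AE x\<in>{s<..<t} in lborel. (?f has_real_derivative 0) (at x)"
      using deriv by eventually_elim (use that in auto)
    show "?f s \<le> ?f t"
      by (rule abs_cont_on_nonneg_deriv_imp_le[OF that(1) ac']) (use d in eventually_elim, auto)
    \<comment> \<open>The reverse inequality is the same monotonicity result for the negative of the
      flux, whose derivative is also zero.\<close>
    have "- ?f s \<le> - ?f t"
    proof (rule abs_cont_on_nonneg_deriv_imp_le[OF that(1)])
      show "abs_cont_on {s..t} (\<lambda>x. - ?f x)"
        using abs_cont_on_mult_left[OF ac', of "-1"] by simp
      show "AE x\<in>{s<..<t} in lborel. \<exists>D\<ge>0. ((\<lambda>x. - ?f x) has_real_derivative D) (at x)"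
        using d by eventually_elim (metis DERIV_minus minus_zero order_refl)
    qed
    then show "?f t \<le> ?f s" by simp
  qed
  show ?thesis using le[of s t] le[of t s] st by linarith
qed

text \<open>Gronwall: \<open>exp (M x) (\<bar>u x\<bar>\<^sup>2 + \<bar>v x\<bar>\<^sup>2)\<close> is nondecreasing for a suitable \<open>M\<close>.\<close>

lemma wave_pair_eq_0:
  assumes w: "wave_pair a b \<eta> \<omega> u v" and \<eta>: "coeff_between \<epsilon> B a b \<eta>" "\<epsilon> > 0"
    and lim: "(u \<longlongrightarrow> 0) (at_left b)" "(v \<longlongrightarrow> 0) (at_left b)" and x: "x \<in> {a<..<b}"
  shows "u x = 0 \<and> v x = 0"
proof -
  \<comment> \<open>\<open>M\<close> bounds the logarithmic growth rate of the energy
    \<open>?E\<close>: the derivative of \<open>?E\<close> is at most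
    \<open>1 / norm (\<eta> x) + \<omega>\<^sup>2 * norm (\<eta> x)\<close> times twice the product
    of the norms of \<open>u\<close> and \<open>v\<close>, and that product is controlled by the sum
    of squares.\<close>
  define M where "M = 1 / \<epsilon> + \<omega>\<^sup>2 * B"
  \<comment> \<open>Written with conjugates rather than norms, so that the product rule and the
    closure properties of absolute continuity apply directly.\<close>
  let ?E = "\<lambda>x. Re (u x * cnj (u x)) + Re (v x * cnj (v x))"
  let ?h = "\<lambda>x. exp (M * x) * ?E x"
  have E: "?E x = (norm (u x))\<^sup>2 + (norm (v x))\<^sup>2" for x
    by (simp only: complex_norm_square[symmetric] Re_complex_of_real)
  have ac_uv: "abs_cont_on {a<..<b} u" "abs_cont_on {a<..<b} v" using w by (auto simp: wave_pair_def)
  have ac_E: "abs_cont_on {a<..<b} ?E"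
    by (intro abs_cont_on_add abs_cont_on_bounded_linear[OF _ bounded_linear_Re]
          abs_cont_on_cmult_cnj ac_uv)
  have ac: "abs_cont_on {a<..<b} ?h"
    by (intro abs_cont_on_mult abs_cont_on_interval_bounded abs_cont_on_exp_mult ac_E)
  have "AE x\<in>{a<..<b} in lborel. (u has_vector_derivative v x / \<eta> x) (at x) \<and>
        (v has_vector_derivative - (of_real (\<omega>\<^sup>2) * \<eta> x * u x)) (at x)"
    using w unfolding wave_pair_def by auto
  with \<eta>(1) have deriv: "AE x\<in>{a<..<b} in lborel. \<exists>D\<ge>0. (?h has_real_derivative D) (at x)"
    unfolding coeff_between_def
  proof (eventually_elim, intro impI)
    fix x assume "x \<in> {a<..<b} \<longrightarrow> (u has_vector_derivative v x / \<eta> x) (at x) \<and>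
        (v has_vector_derivative - (of_real (\<omega>\<^sup>2) * \<eta> x * u x)) (at x)"
      "x \<in> {a<..<b} \<longrightarrow> \<eta> x \<in> \<real> \<and> \<epsilon> \<le> Re (\<eta> x) \<and> norm (\<eta> x) \<le> B" "x \<in> {a<..<b}"
    then have u: "(u has_vector_derivative v x / \<eta> x) (at x)"
      and v: "(v has_vector_derivative - (of_real (\<omega>\<^sup>2) * \<eta> x * u x)) (at x)"
      and ex: "\<epsilon> \<le> Re (\<eta> x)" "norm (\<eta> x) \<le> B" by auto
    have le: "\<epsilon> \<le> norm (\<eta> x)" using ex complex_Re_le_cmod order_trans by blast
    let ?u' = "v x / \<eta> x" let ?v' = "- (of_real (\<omega>\<^sup>2) * \<eta> x * u x)"
    have "((\<lambda>x. u x * cnj (u x)) has_vector_derivative u x * cnj ?u' + ?u' * cnj (u x)) (at x)"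
      "((\<lambda>x. v x * cnj (v x)) has_vector_derivative v x * cnj ?v' + ?v' * cnj (v x)) (at x)"
      by (intro has_vector_derivative_mult has_vector_derivative_cnj u v)+
    then have "(?E has_vector_derivative Re (u x * cnj ?u' + ?u' * cnj (u x)) +
        Re (v x * cnj ?v' + ?v' * cnj (v x))) (at x)"
      by (intro has_vector_derivative_add bounded_linear.has_vector_derivative[OF bounded_linear_Re])
    then have E': "(?E has_real_derivative Re (u x * cnj ?u' + ?u' * cnj (u x)) +
        Re (v x * cnj ?v' + ?v' * cnj (v x))) (at x)" (is "(_ has_real_derivative ?D) _")
      by (simp only: has_real_derivative_iff_has_vector_derivative)
    have h': "(?h has_real_derivative exp (M * x) * (M * ?E x + ?D)) (at x)"
      by (rule derivative_eq_intros E' refl | simp)+ (simp add: algebra_simps)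
    have "\<bar>?D\<bar> \<le> norm (u x * cnj ?u' + ?u' * cnj (u x)) + norm (v x * cnj ?v' + ?v' * cnj (v x))"
      using abs_Re_le_cmod by (smt (verit))
    also have "\<dots> \<le> (norm (u x * cnj ?u') + norm (?u' * cnj (u x))) + (norm (v x * cnj ?v') + norm (?v' * cnj (v x)))"
      by (intro add_mono norm_triangle_ineq)
    also have "\<dots> = 2 * norm (u x) * norm (v x) * (1 / norm (\<eta> x) + \<omega>\<^sup>2 * norm (\<eta> x))"
      by (simp add: norm_mult norm_divide norm_power algebra_simps)
    also have "\<dots> \<le> 2 * norm (u x) * norm (v x) * M"
      unfolding M_def using le ex(2) \<open>\<epsilon> > 0\<close> less_le_trans[OF \<open>\<epsilon> > 0\<close> le]
      by (intro mult_left_mono add_mono divide_left_mono) auto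
    also have "\<dots> \<le> ((norm (u x))\<^sup>2 + (norm (v x))\<^sup>2) * M"
    proof (rule mult_right_mono)
      show "2 * norm (u x) * norm (v x) \<le> (norm (u x))\<^sup>2 + (norm (v x))\<^sup>2"
        using sum_squares_bound[of "norm (u x)" "norm (v x)"] by simp
      have "B \<ge> 0" using ex(2) norm_ge_zero order_trans by blast
      then show "M \<ge> 0" unfolding M_def using \<open>\<epsilon> > 0\<close> by simp
    qed
    finally have "M * ?E x + ?D \<ge> 0" unfolding E[of x] by (simp add: mult.commute abs_le_iff)
    then show "\<exists>D\<ge>0. (?h has_real_derivative D) (at x)"
      using h' by (intro exI[of _ "exp (M * x) * (M * ?E x + ?D)"]) simp
  qed
  have mono: "?h x \<le> ?h t" if t: "x < t" "t < b" for t
  proof (rule abs_cont_on_nonneg_deriv_imp_le[of x t ?h])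
    show "abs_cont_on {x..t} ?h" by (rule abs_cont_on_subset[OF ac]) (use t x in auto)
    show "AE x\<in>{x<..<t} in lborel. \<exists>D\<ge>0. (?h has_real_derivative D) (at x)"
      using deriv by (rule eventually_mono) (use t x in auto)
  qed (use t in simp)
  \<comment> \<open>The weighted energy increases towards \<open>b\<close> but tends to 0 there, so
    it is nonpositive at \<open>x\<close>; being a sum of squares times a positive weight, it
    vanishes.\<close>
  have "(?h \<longlongrightarrow> exp (M * b) * (Re (0 * cnj 0) + Re (0 * cnj 0))) (at_left b)"
    by (intro tendsto_intros lim)
  then have "(?h \<longlongrightarrow> 0) (at_left b)" by simp
  moreover have "\<forall>\<^sub>F t in at_left b. ?h x \<le> ?h t"
    unfolding eventually_at_left_field using mono x by (intro exI[of _ x]) auto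
  ultimately have "?h x \<le> 0"
    by (intro tendsto_lowerbound[of ?h 0 "at_left b"]) auto
  then have "?E x \<le> 0" by (simp add: mult_le_0_iff)
  then have "(norm (u x))\<^sup>2 + (norm (v x))\<^sup>2 \<le> 0" by (simp only: E)
  then show ?thesis by (simp add: sum_power2_le_zero_iff)
qed

section \<open>Existence of solutions with given data at the right endpoint\<close>

text \<open>Writing \<open>F x = exp (L (b - x)) G x\<close> with \<open>L > \<bar>M\<bar>\<close> makes the Picard operator a contraction
  for the supremum norm of \<open>G\<close> on the whole interval.\<close>

lemma backward_ivp_solution:
  fixes A :: "real \<Rightarrow> 'a::euclidean_space \<Rightarrow> 'a"
  assumes "a \<le> b"
    and lip: "\<And>s x y. s \<in> {a..b} \<Longrightarrow> norm (A s x - A s y) \<le> M * norm (x - y)"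
    and int: "\<And>G. continuous_on {a..b} G \<Longrightarrow> (\<lambda>s. A s (G s)) integrable_on {a..b}"
  obtains F where "continuous_on {a..b} F"
    "\<And>x. x \<in> {a..b} \<Longrightarrow> F x = F0 - integral {x..b} (\<lambda>s. A s (F s))"
proof -
  define L where "L = \<bar>M\<bar> + 1"
  have "L > 0" "\<bar>M\<bar> < L" unfolding L_def by auto
  \<comment> \<open>The projection onto \<open>{a..b}\<close> extends functions constantly beyond
    the interval, so that the contraction acts on bounded continuous functions on the whole
    line.\<close>
  define c where "c x = max a (min b x)" for x :: real
  have c: "c x \<in> {a..b}" for x using \<open>a \<le> b\<close> by (auto simp: c_def)
  have c_id: "c x = x" if "x \<in> {a..b}" for x using that by (auto simp: c_def)
  have cont_c: "continuous_on UNIV c" unfolding c_def by (intro continuous_intros)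
  define Q where "Q G x = exp (- L * (b - c x)) *\<^sub>R
      (F0 - integral {c x..b} (\<lambda>s. A s (exp (L * (b - s)) *\<^sub>R G s)))" for G x
  have cont_G: "continuous_on {a..b} (\<lambda>s. exp (L * (b - s)) *\<^sub>R G s)"
    if "continuous_on UNIV G" for G :: "real \<Rightarrow> 'a"
    by (intro continuous_intros continuous_on_subset[OF that]) auto
  have int_G: "(\<lambda>s. A s (exp (L * (b - s)) *\<^sub>R G s)) integrable_on {a..b}"
    if "continuous_on UNIV G" for G :: "real \<Rightarrow> 'a"
    by (rule int[OF cont_G[OF that]])
  have Q: "Q G \<in> bcontfun" if G: "continuous_on UNIV G" for G
  proof -
    define q where "q x = exp (- L * (b - x)) *\<^sub>R
      (F0 - integral {x..b} (\<lambda>s. A s (exp (L * (b - s)) *\<^sub>R G s)))" for x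
    have q: "continuous_on {a..b} q"
      unfolding q_def by (intro continuous_intros indefinite_integral_continuous_1' int_G G)
    then have "compact (q ` {a..b})" by (intro compact_continuous_image) auto
    then have "bounded (q ` {a..b})" by (rule compact_imp_bounded)
    then obtain K where K: "\<And>x. x \<in> {a..b} \<Longrightarrow> norm (q x) \<le> K" unfolding bounded_iff by blast
    have Qq: "Q G = (\<lambda>x. q (c x))" by (auto simp: Q_def q_def)
    show ?thesis
    proof (rule bcontfun_normI)
      show "continuous_on UNIV (Q G)"
        unfolding Qq by (rule continuous_on_compose2[OF q cont_c]) (use c in auto)
      show "norm (Q G x) \<le> K" for x unfolding Qq using K c by blast
    qed
  qed
  define T where "T G = Bcontfun (Q (apply_bcontfun G))" for G
  have T: "apply_bcontfun (T G) = Q (apply_bcontfun G)" for G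
    unfolding T_def by (rule Bcontfun_inverse[OF Q]) (rule continuous_on_apply_bcontfun)
  have contr: "dist (T G) (T H) \<le> (\<bar>M\<bar> / L) * dist G H" for G H
  proof (rule dist_bound)
    fix x
    let ?g = "\<lambda>s. A s (exp (L * (b - s)) *\<^sub>R G s)" and ?h = "\<lambda>s. A s (exp (L * (b - s)) *\<^sub>R H s)"
    let ?D = "dist G H"
    have cx: "c x \<le> b" "{c x..b} \<subseteq> {a..b}" using c[of x] by auto
    have i: "?g integrable_on {c x..b}" "?h integrable_on {c x..b}"
      using integrable_subinterval_real[OF int_G cx(2)] by auto
    \<comment> \<open>Over \<open>{c x..b}\<close> the weight integrates to less than its value at
      \<open>c x\<close> divided by \<open>L\<close>; this is the source of the contraction factor
      \<open>\<bar>M\<bar> / L\<close>.\<close>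
    have e: "((\<lambda>s. exp (L * (b - s))) has_integral (exp (L * (b - c x)) / L - exp (L * (b - b)) / L)) {c x..b}"
    proof -
      have "((\<lambda>s. exp (L * (b - s))) has_integral (- exp (L * (b - b)) / L - (- exp (L * (b - c x)) / L))) {c x..b}"
        by (rule fundamental_theorem_of_calculus[OF cx(1)])
           (use \<open>L > 0\<close> in \<open>auto intro!: derivative_eq_intros
             simp flip: has_real_derivative_iff_has_vector_derivative\<close>)
      then show ?thesis by simp
    qed
    have "norm (integral {c x..b} (\<lambda>s. ?g s - ?h s)) \<le> integral {c x..b} (\<lambda>s. (\<bar>M\<bar> * ?D) * exp (L * (b - s)))"
    proof (rule integral_norm_bound_integral)
      show "(\<lambda>s. ?g s - ?h s) integrable_on {c x..b}" by (rule integrable_diff[OF i])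
      show "(\<lambda>s. (\<bar>M\<bar> * ?D) * exp (L * (b - s))) integrable_on {c x..b}"
        using e by (intro integrable_on_mult_right) blast
      fix s assume "s \<in> {c x..b}"
      then have "norm (?g s - ?h s) \<le> M * norm (exp (L * (b - s)) *\<^sub>R G s - exp (L * (b - s)) *\<^sub>R H s)"
        using cx by (intro lip) auto
      also have "\<dots> = M * (exp (L * (b - s)) * dist (G s) (H s))"
        by (simp add: dist_norm flip: scaleR_diff_right)
      also have "\<dots> \<le> \<bar>M\<bar> * (exp (L * (b - s)) * ?D)"
        by (intro mult_mono dist_bounded) auto
      finally show "norm (?g s - ?h s) \<le> (\<bar>M\<bar> * ?D) * exp (L * (b - s))" by (simp add: algebra_simps)
    qed
    also have "\<dots> = (\<bar>M\<bar> * ?D) * (exp (L * (b - c x)) / L - 1 / L)"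
      using integral_unique[OF e] by simp
    also have "\<dots> \<le> (\<bar>M\<bar> * ?D) * (exp (L * (b - c x)) / L)"
      using \<open>L > 0\<close> by (intro mult_left_mono) auto
    finally have *: "norm (integral {c x..b} (\<lambda>s. ?g s - ?h s)) \<le> (\<bar>M\<bar> * ?D) * (exp (L * (b - c x)) / L)" .
    have "dist (T G x) (T H x) = exp (- L * (b - c x)) * norm (integral {c x..b} (\<lambda>s. ?g s - ?h s))"
      unfolding T Q_def dist_norm
      by (simp add: integral_diff[OF i] norm_minus_commute flip: scaleR_diff_right)
    also have "\<dots> \<le> exp (- L * (b - c x)) * ((\<bar>M\<bar> * ?D) * (exp (L * (b - c x)) / L))"
      using * by (intro mult_left_mono) auto
    also have "\<dots> = (\<bar>M\<bar> / L) * ?D * (exp (- L * (b - c x)) * exp (L * (b - c x)))"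
      by simp
    also have "\<dots> = (\<bar>M\<bar> / L) * ?D" by (simp flip: exp_add)
    finally show "dist (T G x) (T H x) \<le> (\<bar>M\<bar> / L) * ?D" .
  qed
  have "\<exists>!G\<in>UNIV. T G = G"
    by (rule Banach_fix[where c = "\<bar>M\<bar> / L"])
       (use contr \<open>L > 0\<close> \<open>\<bar>M\<bar> < L\<close> in \<open>auto simp: complete_UNIV\<close>)
  then obtain G where "T G = G" by auto
  then have G: "G x = Q G x" for x by (metis T)
  show thesis
  proof (rule that)
    show "continuous_on {a..b} (\<lambda>s. exp (L * (b - s)) *\<^sub>R G s)"
      by (rule cont_G) (rule continuous_on_apply_bcontfun)
    fix x assume x: "x \<in> {a..b}"
    have "exp (L * (b - x)) *\<^sub>R G x = (exp (L * (b - x)) * exp (- L * (b - x))) *\<^sub>R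
      (F0 - integral {x..b} (\<lambda>s. A s (exp (L * (b - s)) *\<^sub>R G s)))"
      by (subst G) (simp add: Q_def c_id[OF x])
    then show "exp (L * (b - x)) *\<^sub>R G x = F0 - integral {x..b} (\<lambda>s. A s (exp (L * (b - s)) *\<^sub>R G s))"
      by (simp flip: exp_add)
  qed
qed

text \<open>Off the finite set \<open>D\<close> the coefficient is continuous, bounded and bounded
  away from zero, so the system is Lipschitz in the state and its integrand is measurable and
  bounded. The Picard solution is then Lipschitz, hence absolutely continuous, and satisfies the
  system off \<open>D\<close>.\<close>

lemma wave_pair_exists:
  assumes "a < b" "finite D" "\<epsilon> > 0"
    and cont: "\<And>x. x \<in> {a<..<b} - D \<Longrightarrow> isCont \<eta> x"
    and bnd: "\<And>x. x \<in> {a<..<b} - D \<Longrightarrow> \<epsilon> \<le> norm (\<eta> x) \<and> norm (\<eta> x) \<le> B"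
  obtains u v where "wave_pair a b \<eta> \<omega> u v" "(u \<longlongrightarrow> ub) (at_left b)" "(v \<longlongrightarrow> vb) (at_left b)"
proof -
  define S where "S = {a<..<b} - D"
  have "open S" unfolding S_def using \<open>finite D\<close> by (intro open_Diff finite_imp_closed) auto
  have cont_\<eta>: "continuous_on S \<eta>"
    using cont by (auto simp: S_def intro: continuous_at_imp_continuous_on)
  have \<eta>0: "\<eta> x \<noteq> 0" if "x \<in> S" for x using bnd[of x] that \<open>\<epsilon> > 0\<close> by (auto simp: S_def)
  define H :: "real \<Rightarrow> complex \<times> complex \<Rightarrow> complex \<times> complex"
    where "H s p = (snd p / \<eta> s, - (of_real (\<omega>\<^sup>2) * \<eta> s * fst p))" for s p
  \<comment> \<open>On \<open>D\<close> the bounds on \<eta> may fail; the value 0 there keeps the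
    Lipschitz estimate valid everywhere and does not affect integrals.\<close>
  define A where "A s p = (if s \<in> S then H s p else 0)" for s p
  define M where "M = 1 / \<epsilon> + \<omega>\<^sup>2 * \<bar>B\<bar>"
  have M: "M \<ge> 0" unfolding M_def using \<open>\<epsilon> > 0\<close> by simp
  have lip: "norm (A s p - A s q) \<le> M * norm (p - q)" for s p q
  proof (cases "s \<in> S")
    case True
    have b: "\<epsilon> \<le> norm (\<eta> s)" "norm (\<eta> s) \<le> \<bar>B\<bar>" using bnd[of s] True by (auto simp: S_def)
    have n: "norm (fst z) \<le> norm z" "norm (snd z) \<le> norm z" for z :: "complex \<times> complex"
      by (metis norm_fst_le prod.collapse, metis norm_snd_le prod.collapse)
    have "A s p - A s q = (snd (p - q) / \<eta> s, - (of_real (\<omega>\<^sup>2) * \<eta> s * fst (p - q)))"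
      using True by (simp add: A_def H_def diff_divide_distrib algebra_simps)
    also have "norm \<dots> \<le> norm (snd (p - q) / \<eta> s) + norm (- (of_real (\<omega>\<^sup>2) * \<eta> s * fst (p - q)))"
      by (rule norm_Pair_le)
    also have "\<dots> = norm (snd (p - q)) * (1 / norm (\<eta> s)) + (\<omega>\<^sup>2 * norm (\<eta> s)) * norm (fst (p - q))"
      by (simp add: norm_divide norm_mult norm_power)
    also have "\<dots> \<le> norm (p - q) * (1 / \<epsilon>) + (\<omega>\<^sup>2 * \<bar>B\<bar>) * norm (p - q)"
      using b \<open>\<epsilon> > 0\<close> less_le_trans[OF \<open>\<epsilon> > 0\<close> b(1)] n[of "p - q"]
      by (intro add_mono mult_mono divide_left_mono mult_left_mono) auto
    also have "\<dots> = M * norm (p - q)" by (simp add: M_def algebra_simps)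
    finally show ?thesis .
  qed (use M in \<open>simp add: A_def\<close>)
  have A0: "A s 0 = 0" for s by (simp add: A_def H_def zero_prod_def)
  have A_le: "norm (A s p) \<le> M * norm p" for s p using lip[of s p 0] by (simp add: A0)
  have cont_H: "continuous_on S (\<lambda>s. H s (G s))" if "continuous_on {a..b} G" for G
  proof -
    have "continuous_on S G" by (rule continuous_on_subset[OF that]) (auto simp: S_def)
    then show ?thesis unfolding H_def
      by (intro continuous_intros cont_\<eta>) (use \<eta>0 in auto)
  qed
  have int: "(\<lambda>s. A s (G s)) integrable_on {a..b}" if G: "continuous_on {a..b} G" for G
  proof -
    have "bounded (G ` {a..b})"
      by (intro compact_imp_bounded compact_continuous_image G) auto
    then obtain C where C: "\<And>x. x \<in> {a..b} \<Longrightarrow> norm (G x) \<le> C" unfolding bounded_iff by blast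
    \<comment> \<open>Measurability comes from continuity on the open set \<open>S\<close>, with the
      extension by zero written as an indicator factor.\<close>
    have "(\<lambda>s. indicator S s *\<^sub>R H s (G s)) \<in> borel_measurable borel"
      by (rule borel_measurable_continuous_on_indicator[OF _ cont_H[OF G]]) (use \<open>open S\<close> in auto)
    moreover have "(\<lambda>s. indicator S s *\<^sub>R H s (G s)) = (\<lambda>s. A s (G s))"
      by (auto simp: A_def fun_eq_iff)
    ultimately have "(\<lambda>s. A s (G s)) \<in> borel_measurable (lebesgue_on {a..b})"
      by (auto intro!: measurable_restrict_space1 measurable_completion)
    then show ?thesis
    proof (rule measurable_bounded_by_integrable_imp_integrable)
      show "(\<lambda>s. M * C) integrable_on {a..b}" by auto
      show "norm (A s (G s)) \<le> M * C" if "s \<in> {a..b}" for s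
        using A_le[of s "G s"] mult_left_mono[OF C[OF that] M] by linarith
    qed auto
  qed
  obtain F where F: "continuous_on {a..b} F"
    "\<And>x. x \<in> {a..b} \<Longrightarrow> F x = (ub, vb) - integral {x..b} (\<lambda>s. A s (F s))"
    using backward_ivp_solution[of a b A M "(ub, vb)", OF less_imp_le[OF \<open>a < b\<close>] lip int] by blast
  have "bounded (F ` {a..b})"
    by (intro compact_imp_bounded compact_continuous_image F) auto
  then obtain C where C: "\<And>x. x \<in> {a..b} \<Longrightarrow> norm (F x) \<le> C" unfolding bounded_iff by blast
  let ?h = "\<lambda>s. A s (F s)"
  have h_le: "norm (?h s) \<le> M * C" if "s \<in> {a..b}" for s
    using A_le[of s "F s"] mult_left_mono[OF C[OF that] M] by linarith
  have diff: "F t - F s = integral {s..t} ?h" if "a \<le> s" "s \<le> t" "t \<le> b" for s t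
  proof -
    have "?h integrable_on {s..b}"
      by (rule integrable_subinterval_real[OF int[OF F(1)]]) (use that in auto)
    then have "integral {s..t} ?h + integral {t..b} ?h = integral {s..b} ?h"
      using that by (intro Henstock_Kurzweil_Integration.integral_combine) auto
    moreover have "F t - F s = integral {s..b} ?h - integral {t..b} ?h"
      by (subst (1 2) F(2)) (use that in auto)
    ultimately show ?thesis by (metis add_diff_cancel_right')
  qed
  have lip_F: "norm (F t - F s) \<le> M * C * \<bar>t - s\<bar>" if st: "s \<in> {a..b}" "t \<in> {a..b}" for s t
  proof -
    have *: "norm (F t - F s) \<le> M * C * (t - s)" if "a \<le> s" "s \<le> t" "t \<le> b" for s t
    proof -
      have "?h integrable_on {s..t}"
        by (rule integrable_subinterval_real[OF int[OF F(1)]]) (use that in auto)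
      then have "norm (integral {s..t} ?h) \<le> M * C * measure lborel {s..t}"
      proof (intro has_integral_bound_real[OF _ finite.emptyI])
        have "norm (?h a) \<ge> 0" by simp
        then show "0 \<le> M * C" using h_le[of a] \<open>a < b\<close> by (smt (verit) atLeastAtMost_iff)
      qed (use h_le that in auto)
      then show ?thesis using diff[OF that] that by simp
    qed
    show ?thesis
      using *[of s t] *[of t s] st by (cases "s \<le> t") (auto simp: norm_minus_commute)
  qed
  have deriv: "(F has_vector_derivative H x (F x)) (at x)" if x: "x \<in> S" for x
  proof -
    have xab: "a < x" "x < b" using x by (auto simp: S_def)
    have "isCont (\<lambda>s. H s (F s)) x"
      using cont_H[OF F(1)] \<open>open S\<close> x by (simp add: continuous_on_eq_continuous_at)
    moreover have eq: "\<forall>\<^sub>F s in nhds x. H s (F s) = ?h s"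
      unfolding eventually_nhds using x \<open>open S\<close> by (intro exI[of _ S]) (auto simp: A_def)
    ultimately have "isCont ?h x" by (simp only: isCont_cong[OF eq])
    \<comment> \<open>The fundamental theorem of calculus is applied in a form with an exceptional
      set, here empty.\<close>
    then have "continuous (at x within ({a..b} - {})) ?h"
      by (rule continuous_at_imp_continuous_at_within)
    then have "((\<lambda>t. integral {a..t} ?h) has_vector_derivative ?h x) (at x within ({a..b} - {}))"
      by (intro integral_has_vector_derivative_continuous_at int F) (use xab in auto)
    then have "((\<lambda>t. integral {a..t} ?h) has_vector_derivative ?h x) (at x)"
      using at_within_Icc_at[OF xab] by simp
    then have "((\<lambda>t. F a + integral {a..t} ?h) has_vector_derivative ?h x) (at x)"
      by (auto intro!: derivative_eq_intros)
    then have "(F has_vector_derivative ?h x) (at x)"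
    proof (rule has_vector_derivative_transform_within_open[of _ _ _ "{a<..<b}"])
      show "F a + integral {a..t} ?h = F t" if "t \<in> {a<..<b}" for t
        using diff[of a t] that by (auto simp: algebra_simps)
    qed (use xab in auto)
    then show ?thesis using x by (simp add: A_def)
  qed
  have ae: "AE x in lborel. x \<notin> D"
    using \<open>finite D\<close> by (intro AE_not_in countable_imp_null_set_lborel countable_finite)
  let ?u = "\<lambda>x. fst (F x)" and ?v = "\<lambda>x. snd (F x)"
  have w: "wave_pair a b \<eta> \<omega> ?u ?v"
    unfolding wave_pair_def
  proof (intro conjI)
    have ac: "abs_cont_on {a<..<b} F"
      by (rule abs_cont_on_Lipschitz[of _ _ "M * C"]) (use lip_F in auto)
    show "abs_cont_on {a<..<b} ?u" "abs_cont_on {a<..<b} ?v"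
      using abs_cont_on_bounded_linear[OF ac bounded_linear_fst]
        abs_cont_on_bounded_linear[OF ac bounded_linear_snd] by auto
    show "AE x\<in>{a<..<b} in lborel. (?u has_vector_derivative ?v x / \<eta> x) (at x) \<and>
        (?v has_vector_derivative - (of_real (\<omega>\<^sup>2) * \<eta> x * ?u x)) (at x)"
      using ae
    proof (eventually_elim, intro impI)
      fix x assume "x \<notin> D" "x \<in> {a<..<b}"
      then have d: "(F has_vector_derivative H x (F x)) (at x)" by (intro deriv) (simp add: S_def)
      show "(?u has_vector_derivative ?v x / \<eta> x) (at x) \<and>
        (?v has_vector_derivative - (of_real (\<omega>\<^sup>2) * \<eta> x * ?u x)) (at x)"
        using bounded_linear.has_vector_derivative[OF bounded_linear_fst d]
          bounded_linear.has_vector_derivative[OF bounded_linear_snd d]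
        by (simp add: H_def)
    qed
  qed
  have "F b = (ub, vb)" using F(2)[of b] \<open>a < b\<close> by simp
  moreover have "(F \<longlongrightarrow> F b) (at_left b)"
    using F(1) \<open>a < b\<close> by (auto simp: continuous_on_def at_within_Icc_at_left[symmetric])
  ultimately have "(?u \<longlongrightarrow> ub) (at_left b)" "(?v \<longlongrightarrow> vb) (at_left b)"
    using tendsto_fst[of F _ "at_left b"] tendsto_snd[of F _ "at_left b"] by fastforce+
  with w show thesis by (rule that)
qed

section \<open>The scattering problem\<close>

lemma coeff_between_tendsto_at_right:
  assumes "coeff_between \<epsilon> B a b \<eta>" "a \<le> c" "c < b" "(\<eta> \<longlongrightarrow> k) (at_right c)"
  shows "k \<in> \<real> \<and> \<epsilon> \<le> Re k"
proof -
  have "closed {z. z \<in> \<real> \<and> \<epsilon> \<le> Re z}"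
    by (intro closed_Collect_conj closed_Collect_le continuous_intros) (simp add: closed_complex_Reals)
  moreover have "AE x\<in>{a<..<b} in lborel. \<eta> x \<in> {z. z \<in> \<real> \<and> \<epsilon> \<le> Re z}"
    using assms(1) unfolding coeff_between_def by (rule eventually_mono) auto
  ultimately show ?thesis using AE_tendsto_at_right_closed assms(2-4) by blast
qed

lemma coeff_between_tendsto_at_left:
  assumes "coeff_between \<epsilon> B a b \<eta>" "a < c" "c \<le> b" "(\<eta> \<longlongrightarrow> k) (at_left c)"
  shows "k \<in> \<real> \<and> \<epsilon> \<le> Re k"
proof -
  have "closed {z. z \<in> \<real> \<and> \<epsilon> \<le> Re z}"
    by (intro closed_Collect_conj closed_Collect_le continuous_intros) (simp add: closed_complex_Reals)
  moreover have "AE x\<in>{a<..<b} in lborel. \<eta> x \<in> {z. z \<in> \<real> \<and> \<epsilon> \<le> Re z}"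
    using assms(1) unfolding coeff_between_def by (rule eventually_mono) auto
  ultimately show ?thesis using AE_tendsto_at_left_closed assms(2-4) by blast
qed

definition left_wave :: "real \<Rightarrow> complex \<Rightarrow> complex \<Rightarrow> complex \<Rightarrow> complex" where
  "left_wave \<omega> k u v = 1/2 * (u - v / (\<i> * of_real \<omega> * k))"

definition right_wave :: "real \<Rightarrow> complex \<Rightarrow> complex \<Rightarrow> complex \<Rightarrow> complex" where
  "right_wave \<omega> k u v = 1/2 * (u + v / (\<i> * of_real \<omega> * k))"

lemma wave_sum_diff:
  assumes "\<omega> \<noteq> 0" "k \<noteq> 0"
  shows "u = right_wave \<omega> k u v + left_wave \<omega> k u v"
    and "v = \<i> * of_real \<omega> * k * (right_wave \<omega> k u v - left_wave \<omega> k u v)"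
  using assms by (simp_all add: left_wave_def right_wave_def field_simps)

text \<open>With \<open>v / \<eta>\<close> as representative of the derivative, the wave parts are
  continuous functions of \<eta>, \<open>u\<close> and \<open>v\<close>; the limits of \<eta> at the
  endpoints are nonzero, so all limits pass through.\<close>

lemma scattering_solution_of_wave_pair:
  assumes "a < b" "\<omega> \<noteq> 0" and \<eta>: "coeff_between \<epsilon> B a b \<eta>" "\<epsilon> > 0"
    and lim: "(\<eta> \<longlongrightarrow> k) (at_right a)" "(\<eta> \<longlongrightarrow> m) (at_left b)"
    and w: "wave_pair a b \<eta> \<omega> u v"
    and a: "(u \<longlongrightarrow> ua) (at_right a)" "(v \<longlongrightarrow> va) (at_right a)"
    and b: "(u \<longlongrightarrow> ub) (at_left b)" "(v \<longlongrightarrow> vb) (at_left b)"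
    and bd: "right_wave \<omega> k ua va = 1" "left_wave \<omega> m ub vb = \<xi> * right_wave \<omega> m ub vb"
  shows "scattering_solution a b \<eta> \<omega> \<xi> u (\<lambda>x. v x / \<eta> x)"
    and "(left_part \<omega> u (\<lambda>x. v x / \<eta> x) \<longlongrightarrow> left_wave \<omega> k ua va) (at_right a)"
proof -
  have km: "k \<noteq> 0" "m \<noteq> 0"
    using coeff_between_tendsto_at_right[OF \<eta>(1) _ _ lim(1)]
      coeff_between_tendsto_at_left[OF \<eta>(1) _ _ lim(2)] \<open>a < b\<close> \<open>\<epsilon> > 0\<close> by auto
  have "left_part \<omega> u (\<lambda>x. v x / \<eta> x) = (\<lambda>x. left_wave \<omega> (\<eta> x) (u x) (v x))"
    "right_part \<omega> u (\<lambda>x. v x / \<eta> x) = (\<lambda>x. right_wave \<omega> (\<eta> x) (u x) (v x))"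
    by (auto simp: fun_eq_iff left_part_def right_part_def left_wave_def right_wave_def)
  note parts = this[unfolded left_wave_def right_wave_def]
  show "(left_part \<omega> u (\<lambda>x. v x / \<eta> x) \<longlongrightarrow> left_wave \<omega> k ua va) (at_right a)"
    unfolding parts left_wave_def by (intro tendsto_intros a lim) (use km \<open>\<omega> \<noteq> 0\<close> in auto)
  have "(right_part \<omega> u (\<lambda>x. v x / \<eta> x) \<longlongrightarrow> right_wave \<omega> k ua va) (at_right a)"
    unfolding parts right_wave_def by (intro tendsto_intros a lim) (use km \<open>\<omega> \<noteq> 0\<close> in auto)
  moreover have "(left_part \<omega> u (\<lambda>x. v x / \<eta> x) \<longlongrightarrow> left_wave \<omega> m ub vb) (at_left b)"
    unfolding parts left_wave_def by (intro tendsto_intros b lim) (use km \<open>\<omega> \<noteq> 0\<close> in auto)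
  moreover have "(right_part \<omega> u (\<lambda>x. v x / \<eta> x) \<longlongrightarrow> right_wave \<omega> m ub vb) (at_left b)"
    unfolding parts right_wave_def by (intro tendsto_intros b lim) (use km \<open>\<omega> \<noteq> 0\<close> in auto)
  moreover have "wave_solution a b \<eta> \<omega> u (\<lambda>x. v x / \<eta> x)"
    unfolding wave_solution_def
  proof (intro conjI exI[of _ v])
    have deriv: "AE x\<in>{a<..<b} in lborel. (u has_vector_derivative v x / \<eta> x) (at x) \<and>
        (v has_vector_derivative - (of_real (\<omega>\<^sup>2) * \<eta> x * u x)) (at x)"
      using w unfolding wave_pair_def by auto
    then show "AE x\<in>{a<..<b} in lborel. (u has_vector_derivative v x / \<eta> x) (at x)"
      by (rule eventually_mono) auto
    from deriv show "AE x\<in>{a<..<b} in lborel. \<exists>w'. (v has_vector_derivative w') (at x) \<and>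
        w' + of_real (\<omega>\<^sup>2) * \<eta> x * u x = 0"
      by (rule eventually_mono) force
    show "AE x\<in>{a<..<b} in lborel. v x = \<eta> x * (v x / \<eta> x)"
      using \<eta>(1) unfolding coeff_between_def by (rule eventually_mono) (use \<eta>(2) in force)
  qed (use w in \<open>auto simp: wave_pair_def\<close>)
  ultimately show "scattering_solution a b \<eta> \<omega> \<xi> u (\<lambda>x. v x / \<eta> x)"
    unfolding scattering_solution_def using bd by metis
qed

text \<open>The converse passage. Limits of the two wave parts give limits of \<open>u\<close> and
  \<open>u'\<close>. The relation \<open>v x = \<eta> x * u' x\<close> holds only almost everywhere,
  but all three functions have endpoint limits, so it persists there.\<close>

lemma scattering_solution_wave_pair:
  assumes "a < b" "\<omega> \<noteq> 0" and \<eta>: "coeff_between \<epsilon> B a b \<eta>" "\<epsilon> > 0"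
    and lim: "(\<eta> \<longlongrightarrow> k) (at_right a)" "(\<eta> \<longlongrightarrow> m) (at_left b)"
    and s: "scattering_solution a b \<eta> \<omega> \<xi> u u'"
    and z: "(left_part \<omega> u u' \<longlongrightarrow> z) (at_right a)"
  obtains v p where "wave_pair a b \<eta> \<omega> u v"
    "(u \<longlongrightarrow> 1 + z) (at_right a)" "(v \<longlongrightarrow> k * (\<i> * of_real \<omega> * (1 - z))) (at_right a)"
    "(u \<longlongrightarrow> p + \<xi> * p) (at_left b)" "(v \<longlongrightarrow> m * (\<i> * of_real \<omega> * (p - \<xi> * p))) (at_left b)"
proof -
  obtain p where p: "(right_part \<omega> u u' \<longlongrightarrow> 1) (at_right a)"
     "(right_part \<omega> u u' \<longlongrightarrow> p) (at_left b)" "(left_part \<omega> u u' \<longlongrightarrow> \<xi> * p) (at_left b)"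
    using s unfolding scattering_solution_def by blast
  have ws: "wave_solution a b \<eta> \<omega> u u'" using s unfolding scattering_solution_def by blast
  then obtain v where v: "abs_cont_on {a<..<b} v" "AE x\<in>{a<..<b} in lborel. v x = \<eta> x * u' x"
    "AE x\<in>{a<..<b} in lborel. \<exists>w'. (v has_vector_derivative w') (at x) \<and>
        w' + of_real (\<omega>\<^sup>2) * \<eta> x * u x = 0"
    and u: "abs_cont_on {a<..<b} u" "AE x\<in>{a<..<b} in lborel. (u has_vector_derivative u' x) (at x)"
    unfolding wave_solution_def by blast
  have "AE x\<in>{a<..<b} in lborel. (u has_vector_derivative v x / \<eta> x) (at x) \<and>
        (v has_vector_derivative - (of_real (\<omega>\<^sup>2) * \<eta> x * u x)) (at x)"
    using \<eta>(1) v(2,3) u(2) unfolding coeff_between_def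
  proof (eventually_elim, intro impI conjI)
    fix x assume "x \<in> {a<..<b} \<longrightarrow> \<eta> x \<in> \<real> \<and> \<epsilon> \<le> Re (\<eta> x) \<and> norm (\<eta> x) \<le> B"
      "x \<in> {a<..<b} \<longrightarrow> v x = \<eta> x * u' x"
      "x \<in> {a<..<b} \<longrightarrow> (\<exists>w'. (v has_vector_derivative w') (at x) \<and>
        w' + of_real (\<omega>\<^sup>2) * \<eta> x * u x = 0)"
      "x \<in> {a<..<b} \<longrightarrow> (u has_vector_derivative u' x) (at x)" "x \<in> {a<..<b}"
    then have h: "\<epsilon> \<le> Re (\<eta> x)" "v x = \<eta> x * u' x" "(u has_vector_derivative u' x) (at x)"
      "\<exists>w'. (v has_vector_derivative w') (at x) \<and> w' + of_real (\<omega>\<^sup>2) * \<eta> x * u x = 0" by blast+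
    have "\<eta> x \<noteq> 0" using h(1) \<open>\<epsilon> > 0\<close> by auto
    then show "(u has_vector_derivative v x / \<eta> x) (at x)" using h(2,3) by simp
    show "(v has_vector_derivative - (of_real (\<omega>\<^sup>2) * \<eta> x * u x)) (at x)"
      using h(4) by (metis eq_neg_iff_add_eq_0)
  qed
  then have w: "wave_pair a b \<eta> \<omega> u v" unfolding wave_pair_def using u v by blast
  have parts: "u = (\<lambda>x. right_part \<omega> u u' x + left_part \<omega> u u' x)"
    "u' = (\<lambda>x. \<i> * of_real \<omega> * (right_part \<omega> u u' x - left_part \<omega> u u' x))"
    using \<open>\<omega> \<noteq> 0\<close> by (auto simp: fun_eq_iff left_part_def right_part_def field_simps)
  have lu: "(u \<longlongrightarrow> 1 + z) (at_right a)" "(u \<longlongrightarrow> p + \<xi> * p) (at_left b)"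
    by (subst parts(1), intro tendsto_intros p z)+
  have lu': "(u' \<longlongrightarrow> \<i> * of_real \<omega> * (1 - z)) (at_right a)"
    "(u' \<longlongrightarrow> \<i> * of_real \<omega> * (p - \<xi> * p)) (at_left b)"
    by (subst parts(2), intro tendsto_intros p z)+
  obtain va vb where vab: "(v \<longlongrightarrow> va) (at_right a)" "(v \<longlongrightarrow> vb) (at_left b)"
    using abs_cont_on_tendsto_endpoints[OF v(1) \<open>a < b\<close>] by blast
  have ae: "AE x\<in>{a<..<b} in lborel. v x - \<eta> x * u' x \<in> {0}"
    using v(2) by (rule eventually_mono) auto
  have "va - k * (\<i> * of_real \<omega> * (1 - z)) \<in> {0}"
    by (rule AE_tendsto_at_right_closed[OF ae]) (use \<open>a < b\<close> in \<open>auto intro!: tendsto_intros vab lim lu'\<close>)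
  moreover have "vb - m * (\<i> * of_real \<omega> * (p - \<xi> * p)) \<in> {0}"
    by (rule AE_tendsto_at_left_closed[OF ae]) (use \<open>a < b\<close> in \<open>auto intro!: tendsto_intros vab lim lu'\<close>)
  ultimately show thesis using that[OF w lu(1) _ lu(2)] vab by simp
qed

section \<open>Well-definedness of the reflection coefficient\<close>

lemma wave_pair_tendsto_0:
  assumes "a < b" and \<eta>: "coeff_between \<epsilon> B a b \<eta>" "\<epsilon> > 0" and w: "wave_pair a b \<eta> \<omega> u v"
    and b: "(u \<longlongrightarrow> 0) (at_left b)" "(v \<longlongrightarrow> 0) (at_left b)"
    and a: "(u \<longlongrightarrow> ua) (at_right a)" "(v \<longlongrightarrow> va) (at_right a)"
  shows "ua = 0" "va = 0"
proof -
  have z: "u x = 0 \<and> v x = 0" if "x \<in> {a<..<b}" for x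
    by (rule wave_pair_eq_0[OF w \<eta> b that])
  have "ua \<in> {0}"
    by (rule AE_tendsto_at_right_closed[of a b u _ a]) (use z a \<open>a < b\<close> in auto)
  moreover have "va \<in> {0}"
    by (rule AE_tendsto_at_right_closed[of a b v _ a]) (use z a \<open>a < b\<close> in auto)
  ultimately show "ua = 0" "va = 0" by auto
qed

text \<open>Division by the right-going amplitude at \<open>a\<close> normalizes the given solution,
  which yields existence. The condition at \<open>b\<close> leaves one free scalar and data at
  \<open>b\<close> determine a solution, so any competitor is a multiple of this one and has the
  same quotient at \<open>a\<close>.\<close>

lemma reflection_coeff_eq:
  assumes "a < b" "\<omega> \<noteq> 0" and \<eta>: "coeff_between \<epsilon> B a b \<eta>" "\<epsilon> > 0"
    and lim: "(\<eta> \<longlongrightarrow> k) (at_right a)" "(\<eta> \<longlongrightarrow> m) (at_left b)"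
    and w: "wave_pair a b \<eta> \<omega> u v"
    and a: "(u \<longlongrightarrow> ua) (at_right a)" "(v \<longlongrightarrow> va) (at_right a)"
    and b: "(u \<longlongrightarrow> ub) (at_left b)" "(v \<longlongrightarrow> vb) (at_left b)"
    and R0: "right_wave \<omega> k ua va \<noteq> 0"
    and bd: "left_wave \<omega> m ub vb = \<xi> * right_wave \<omega> m ub vb"
  shows "reflection_coeff a b \<eta> \<omega> \<xi> = left_wave \<omega> k ua va / right_wave \<omega> k ua va"
  unfolding reflection_coeff_def
proof (rule the_equality)
  define R where "R = right_wave \<omega> k ua va"
  define L where "L = left_wave \<omega> k ua va"
  define p where "p = right_wave \<omega> m ub vb"
  have km: "k \<noteq> 0" "m \<noteq> 0"
    using coeff_between_tendsto_at_right[OF \<eta>(1) _ _ lim(1)]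
      coeff_between_tendsto_at_left[OF \<eta>(1) _ _ lim(2)] \<open>a < b\<close> \<open>\<epsilon> > 0\<close> by auto
  have uva: "ua = R + L" "va = \<i> * of_real \<omega> * k * (R - L)"
    unfolding R_def L_def using wave_sum_diff[OF \<open>\<omega> \<noteq> 0\<close> km(1)] by blast+
  have uvb: "ub = p + \<xi> * p" "vb = \<i> * of_real \<omega> * m * (p - \<xi> * p)"
    unfolding p_def bd[symmetric] using wave_sum_diff[OF \<open>\<omega> \<noteq> 0\<close> km(2)] by blast+
  have w': "wave_pair a b \<eta> \<omega> (\<lambda>x. (1 / R) * u x) (\<lambda>x. (1 / R) * v x)"
    using wave_pair_linear_combination[OF w w, of "1 / R" 0] by simp
  have "left_wave \<omega> k ((1 / R) * ua) ((1 / R) * va) = L / R"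
    "right_wave \<omega> k ((1 / R) * ua) ((1 / R) * va) = 1"
    "left_wave \<omega> m ((1 / R) * ub) ((1 / R) * vb) = \<xi> * right_wave \<omega> m ((1 / R) * ub) ((1 / R) * vb)"
  proof -
    have s: "left_wave \<omega> c ((1 / R) * x) ((1 / R) * y) = left_wave \<omega> c x y / R"
      "right_wave \<omega> c ((1 / R) * x) ((1 / R) * y) = right_wave \<omega> c x y / R" for c x y
      by (simp_all add: left_wave_def right_wave_def diff_divide_distrib add_divide_distrib mult.commute)
    show "left_wave \<omega> k ((1 / R) * ua) ((1 / R) * va) = L / R"
      "right_wave \<omega> k ((1 / R) * ua) ((1 / R) * va) = 1"
      "left_wave \<omega> m ((1 / R) * ub) ((1 / R) * vb) = \<xi> * right_wave \<omega> m ((1 / R) * ub) ((1 / R) * vb)"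
      unfolding s using R0 bd by (auto simp: L_def R_def)
  qed
  note bd' = this
  note sc = scattering_solution_of_wave_pair[OF assms(1-6) w' tendsto_mult_left[OF a(1)]
      tendsto_mult_left[OF a(2)] tendsto_mult_left[OF b(1)] tendsto_mult_left[OF b(2)] bd'(2,3)]
  show "\<exists>u u'. scattering_solution a b \<eta> \<omega> \<xi> u u' \<and>
      (left_part \<omega> u u' \<longlongrightarrow> left_wave \<omega> k ua va / right_wave \<omega> k ua va) (at_right a)"
    using sc(1) sc(2)[unfolded bd'(1)] unfolding L_def[symmetric] R_def[symmetric] by blast
  fix z assume "\<exists>u u'. scattering_solution a b \<eta> \<omega> \<xi> u u' \<and> (left_part \<omega> u u' \<longlongrightarrow> z) (at_right a)"
  then obtain u2 u2' where s2: "scattering_solution a b \<eta> \<omega> \<xi> u2 u2'"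
     "(left_part \<omega> u2 u2' \<longlongrightarrow> z) (at_right a)" by blast
  obtain v2 p2 where 2: "wave_pair a b \<eta> \<omega> u2 v2"
    "(u2 \<longlongrightarrow> 1 + z) (at_right a)" "(v2 \<longlongrightarrow> k * (\<i> * of_real \<omega> * (1 - z))) (at_right a)"
    "(u2 \<longlongrightarrow> p2 + \<xi> * p2) (at_left b)" "(v2 \<longlongrightarrow> m * (\<i> * of_real \<omega> * (p2 - \<xi> * p2))) (at_left b)"
    using scattering_solution_wave_pair[OF assms(1-6) s2] by blast
  \<comment> \<open>A vanishing amplitude at \<open>b\<close> would make both components vanish
    there, hence also at \<open>a\<close>, against \<open>R0\<close>.\<close>
  have "p \<noteq> 0"
  proof
    assume "p = 0"
    then have "(u \<longlongrightarrow> 0) (at_left b)" "(v \<longlongrightarrow> 0) (at_left b)" using b uvb by auto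
    from wave_pair_tendsto_0[OF \<open>a < b\<close> \<eta> w this a] have "R = 0" by (simp add: R_def right_wave_def)
    then show False using R0 by (simp add: R_def)
  qed
  \<comment> \<open>Cross-multiplying by the two amplitudes at \<open>b\<close> cancels the data
    there, so the combination is zero up to \<open>a\<close>.\<close>
  let ?U = "\<lambda>x. p2 * u x - p * u2 x" and ?V = "\<lambda>x. p2 * v x - p * v2 x"
  have "wave_pair a b \<eta> \<omega> ?U ?V" by (rule wave_pair_linear_combination[OF w 2(1)])
  moreover have "(?U \<longlongrightarrow> p2 * ub - p * (p2 + \<xi> * p2)) (at_left b)"
    by (intro tendsto_intros b 2)
  moreover have "p2 * ub - p * (p2 + \<xi> * p2) = 0" by (simp add: uvb algebra_simps)
  moreover have "(?V \<longlongrightarrow> p2 * vb - p * (m * (\<i> * of_real \<omega> * (p2 - \<xi> * p2)))) (at_left b)"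
    by (intro tendsto_intros b 2)
  moreover have "p2 * vb - p * (m * (\<i> * of_real \<omega> * (p2 - \<xi> * p2))) = 0"
    by (simp add: uvb algebra_simps)
  moreover have "(?U \<longlongrightarrow> p2 * ua - p * (1 + z)) (at_right a)"
    by (intro tendsto_intros a 2)
  moreover have "(?V \<longlongrightarrow> p2 * va - p * (k * (\<i> * of_real \<omega> * (1 - z)))) (at_right a)"
    by (intro tendsto_intros a 2)
  ultimately have e: "p2 * ua - p * (1 + z) = 0" "p2 * va - p * (k * (\<i> * of_real \<omega> * (1 - z))) = 0"
    using wave_pair_tendsto_0[OF \<open>a < b\<close> \<eta>, of \<omega> ?U ?V] by metis+
  from e(2) have "(\<i> * of_real \<omega> * k) * (p2 * (R - L) - p * (1 - z)) = 0"
    by (simp add: uva algebra_simps)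
  then have "p2 * (R - L) - p * (1 - z) = 0" using km \<open>\<omega> \<noteq> 0\<close> by simp
  moreover have "p2 * (R + L) - p * (1 + z) = 0" using e(1) by (simp add: uva)
  \<comment> \<open>Sum and difference of the two equations separate the right-going from the
    left-going amplitude at \<open>a\<close>.\<close>
  ultimately have "2 * (p2 * R - p) = 0" "2 * (p2 * L - p * z) = 0" by (simp_all only: algebra_simps) algebra+
  then have "p2 * R = p" "p2 * L = p * z" by simp_all
  then have "p2 \<noteq> 0" "p2 * L = p2 * (R * z)" using \<open>p \<noteq> 0\<close> by auto
  then have "L = R * z" by simp
  then show "z = left_wave \<omega> k ua va / right_wave \<omega> k ua va"
    using R0 by (simp add: L_def R_def)
qed

section \<open>Composition\<close>

lemma Cpw_right_piece:
  assumes "f \<in> Cpw a b" "a \<le> c" "c < b"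
  obtains d where "c < d" "d \<le> b" "abs_cont_on {c<..<d} f"
proof -
  obtain P where P: "finite P" "\<And>c d. c < d \<Longrightarrow> {c<..<d} \<subseteq> {a<..<b} - P \<Longrightarrow> abs_cont_on {c<..<d} f"
    using assms(1) unfolding Cpw_def by blast
  \<comment> \<open>The piece ends at the next partition point to the right of \<open>c\<close>;
    \<open>b\<close> is added so that the minimum exists and the piece stays inside the
    interval.\<close>
  define Q where "Q = insert b {p\<in>P. c < p}"
  have Q: "finite Q" "Q \<noteq> {}" using P(1) by (auto simp: Q_def)
  have "Min Q \<in> Q" using Q by simp
  then have "c < Min Q" using assms by (auto simp: Q_def)
  have "Min Q \<le> b" using Q by (simp add: Q_def)
  have "{c<..<Min Q} \<subseteq> {a<..<b} - P"
  proof
    fix x assume x: "x \<in> {c<..<Min Q}"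
    have "x \<notin> P"
    proof
      assume "x \<in> P"
      then have "x \<in> Q" using x by (simp add: Q_def)
      then have "Min Q \<le> x" using Q by simp
      then show False using x by simp
    qed
    then show "x \<in> {a<..<b} - P" using x \<open>Min Q \<le> b\<close> assms by auto
  qed
  with that P(2) \<open>c < Min Q\<close> \<open>Min Q \<le> b\<close> show thesis by blast
qed

lemma Cpw_left_piece:
  assumes "f \<in> Cpw a b" "a < c" "c \<le> b"
  obtains d where "a \<le> d" "d < c" "abs_cont_on {d<..<c} f"
proof -
  obtain P where P: "finite P" "\<And>c d. c < d \<Longrightarrow> {c<..<d} \<subseteq> {a<..<b} - P \<Longrightarrow> abs_cont_on {c<..<d} f"
    using assms(1) unfolding Cpw_def by blast
  define Q where "Q = insert a {p\<in>P. p < c}"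
  have Q: "finite Q" "Q \<noteq> {}" using P(1) by (auto simp: Q_def)
  have "Max Q \<in> Q" using Q by simp
  then have "Max Q < c" using assms by (auto simp: Q_def)
  have "a \<le> Max Q" using Q by (simp add: Q_def)
  have "{Max Q<..<c} \<subseteq> {a<..<b} - P"
  proof
    fix x assume x: "x \<in> {Max Q<..<c}"
    have "x \<notin> P"
    proof
      assume "x \<in> P"
      then have "x \<in> Q" using x by (simp add: Q_def)
      then have "x \<le> Max Q" using Q by simp
      then show False using x by simp
    qed
    then show "x \<in> {a<..<b} - P" using x \<open>a \<le> Max Q\<close> assms by auto
  qed
  with that P(2) \<open>Max Q < c\<close> \<open>a \<le> Max Q\<close> show thesis by blast
qed

text \<open>\<open>Lim\<close> is only a description; this certifies that it denotes an actual
  limit, so that the reflection numbers \<open>r j\<close> have the intended meaning.\<close>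

lemma Cpw_tendsto_at_right:
  assumes "f \<in> Cpw a b" "a \<le> c" "c < b"
  shows "(f \<longlongrightarrow> Lim (at_right c) f) (at_right c)"
proof -
  obtain d where d: "c < d" "abs_cont_on {c<..<d} f" using Cpw_right_piece[OF assms] by blast
  obtain l where "(f \<longlongrightarrow> l) (at_right c)" by (rule abs_cont_on_tendsto_endpoints[OF d(2,1)])
  then show ?thesis using tendsto_Lim[OF trivial_limit_at_right_real] by blast
qed

lemma Cpw_tendsto_at_left:
  assumes "f \<in> Cpw a b" "a < c" "c \<le> b"
  shows "(f \<longlongrightarrow> Lim (at_left c) f) (at_left c)"
proof -
  obtain d where d: "d < c" "abs_cont_on {d<..<c} f" using Cpw_left_piece[OF assms] by blast
  obtain l where "(f \<longlongrightarrow> l) (at_left c)" by (rule abs_cont_on_tendsto_endpoints[OF d(2,1)])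
  then show ?thesis using tendsto_Lim[OF trivial_limit_at_left_real] by blast
qed

text \<open>A compactness argument by bisection: near each point the function is bounded on a piece
  to the left and a piece to the right, and the value at the point itself is one more bound.\<close>

lemma Cpw_bounded:
  assumes f: "f \<in> Cpw a b" and "a \<le> b"
  obtains B where "\<And>x. x \<in> {a<..<b} \<Longrightarrow> norm (f x) \<le> B"
proof -
  define Q where "Q p q \<longleftrightarrow> (\<exists>B. \<forall>z\<in>{p..q} \<inter> {a<..<b}. norm (f z) \<le> B)" for p q
  from \<open>a \<le> b\<close> have "Q a b"
  proof (induction rule: Bolzano)
    case (trans p q s)
    then obtain B C where "\<forall>z\<in>{p..q} \<inter> {a<..<b}. norm (f z) \<le> B" "\<forall>z\<in>{q..s} \<inter> {a<..<b}. norm (f z) \<le> C"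
      unfolding Q_def by blast
    then have "norm (f z) \<le> max B C" if "z \<in> {p..s} \<inter> {a<..<b}" for z
      using that by (cases "z \<le> q") (auto simp: le_max_iff_disj)
    then show ?case unfolding Q_def by blast
  next
    case (local x)
    have bdd: "\<exists>B. \<forall>z\<in>{c<..<d}. norm (f z) \<le> B" if "abs_cont_on {c<..<d} f" for c d
      using abs_cont_on_interval_bounded[OF that] by (simp add: bounded_iff)
    have R: "\<exists>d>x. \<exists>B. \<forall>z\<in>{x<..<d} \<inter> {a<..<b}. norm (f z) \<le> B"
    proof (cases "x < b")
      case True
      with local obtain d where d: "x < d" "abs_cont_on {x<..<d} f"
        using Cpw_right_piece[OF f, of x] by blast
      then show ?thesis using bdd[OF d(2)] by blast
    next
      case False
      then have "{x<..<x + 1} \<inter> {a<..<b} = {}" by auto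
      then show ?thesis by (intro exI[of _ "x + 1"]) auto
    qed
    have L: "\<exists>d<x. \<exists>B. \<forall>z\<in>{d<..<x} \<inter> {a<..<b}. norm (f z) \<le> B"
    proof (cases "a < x")
      case True
      with local obtain d where d: "d < x" "abs_cont_on {d<..<x} f"
        using Cpw_left_piece[OF f, of x] by blast
      then show ?thesis using bdd[OF d(2)] by blast
    next
      case False
      then have "{x - 1<..<x} \<inter> {a<..<b} = {}" by auto
      then show ?thesis by (intro exI[of _ "x - 1"]) auto
    qed
    from R obtain d1 B where d1: "d1 > x" "\<forall>z\<in>{x<..<d1} \<inter> {a<..<b}. norm (f z) \<le> B" by blast
    from L obtain d0 C where d0: "d0 < x" "\<forall>z\<in>{d0<..<x} \<inter> {a<..<b}. norm (f z) \<le> C" by blast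
    show ?case
    proof (intro exI[of _ "min (d1 - x) (x - d0)"] conjI allI impI)
      fix p q assume pq: "p \<le> x \<and> x \<le> q \<and> q - p < min (d1 - x) (x - d0)"
      have "norm (f z) \<le> max (norm (f x)) (max B C)" if "z \<in> {p..q} \<inter> {a<..<b}" for z
        using that pq d1(2) d0(2) by (cases z x rule: linorder_cases) (auto simp: le_max_iff_disj)
      then show "Q p q" unfolding Q_def by blast
    qed (use d1 d0 in auto)
  qed
  then obtain B where "\<forall>z\<in>{a..b} \<inter> {a<..<b}. norm (f z) \<le> B" unfolding Q_def by blast
  then show thesis using that[of B] by auto
qed

section \<open>Wave amplitudes, flux and the effect of a jump\<close>

lemma flux_eq_norm_waves:
  assumes "\<omega> \<noteq> 0" "k \<in> \<real>" "k \<noteq> 0"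
  shows "Im (v * cnj u) = \<omega> * Re k * ((norm (right_wave \<omega> k u v))\<^sup>2 - (norm (left_wave \<omega> k u v))\<^sup>2)"
proof -
  define R L where "R = right_wave \<omega> k u v" and "L = left_wave \<omega> k u v"
  obtain c where c: "k = of_real c" using assms by (auto elim: Reals_cases)
  have "u = R + L" "v = \<i> * of_real \<omega> * k * (R - L)"
    unfolding R_def L_def using wave_sum_diff[OF assms(1,3)] by blast+
  \<comment> \<open>The real part of \<open>(R - L) * cnj (R + L)\<close> is the difference of the
    squared moduli, since the cross terms are purely imaginary; the factor \<i> turns it into the
    imaginary part, as \<open>k\<close> is real.\<close>
  then have "v * cnj u = (\<i> * of_real \<omega> * k * (R - L)) * cnj (R + L)" by simp
  also have "Im \<dots> = \<omega> * Re k * ((Re R)\<^sup>2 + (Im R)\<^sup>2 - ((Re L)\<^sup>2 + (Im L)\<^sup>2))"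
    by (simp add: c power2_eq_square algebra_simps)
  also have "\<dots> = \<omega> * Re k * ((norm R)\<^sup>2 - (norm L)\<^sup>2)" by (simp add: cmod_power2)
  finally show ?thesis by (simp add: R_def L_def)
qed

text \<open>At a jump \<open>u\<close> and \<open>v\<close> are shared by both sides; only the
  coefficient changes, from \<open>k\<close> on the right to \<open>m\<close> on the left. The
  amplitudes for \<open>m\<close> are linear in those for \<open>k\<close>, so their quotient
  undergoes a Moebius map, and its parameter is real because \<open>k\<close> and \<open>m\<close>
  are.\<close>

lemma disk_automorphism_waves:
  assumes "\<omega> \<noteq> 0" "k \<in> \<real>" "m \<in> \<real>" "k \<noteq> 0" "m \<noteq> 0" "m + k \<noteq> 0"
    and R: "right_wave \<omega> k u v \<noteq> 0"
  shows "disk_automorphism 1 ((m - k) / (m + k)) (left_wave \<omega> k u v / right_wave \<omega> k u v) =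
    left_wave \<omega> m u v / right_wave \<omega> m u v"
proof -
  define R L where "R = right_wave \<omega> k u v" and "L = left_wave \<omega> k u v"
  \<comment> \<open>The common nonzero factor by which numerator and denominator of the Moebius map
    exceed the two amplitudes for \<open>m\<close>.\<close>
  define q where "q = 2 * m / ((m + k) * R)"
  have q: "q \<noteq> 0" using assms by (simp add: q_def R_def)
  have uv: "u = R + L" "v = \<i> * of_real \<omega> * k * (R - L)"
    unfolding R_def L_def using wave_sum_diff[OF assms(1,4)] by blast+
  have Rm: "2 * m * right_wave \<omega> m u v = (m + k) * R + (m - k) * L"
    and Lm: "2 * m * left_wave \<omega> m u v = (m - k) * R + (m + k) * L"
    unfolding right_wave_def left_wave_def uv using assms by (simp_all add: field_simps)
  have "cnj ((m - k) / (m + k)) = (m - k) / (m + k)"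
    using assms by (simp add: Reals_cnj_iff)
  moreover have "L / R + (m - k) / (m + k) = q * left_wave \<omega> m u v"
  proof -
    have "q * left_wave \<omega> m u v = ((m - k) * R + (m + k) * L) / ((m + k) * R)"
      unfolding q_def Lm[symmetric] by simp
    also have "\<dots> = L / R + (m - k) / (m + k)"
      using assms unfolding R_def[symmetric] by (simp add: add_divide_distrib)
    finally show ?thesis by simp
  qed
  moreover have "1 + (m - k) / (m + k) * (L / R) = q * right_wave \<omega> m u v"
  proof -
    have "q * right_wave \<omega> m u v = ((m + k) * R + (m - k) * L) / ((m + k) * R)"
      unfolding q_def Rm[symmetric] by simp
    also have "\<dots> = 1 + (m - k) / (m + k) * (L / R)"
      using assms unfolding R_def[symmetric] by (simp add: add_divide_distrib)
    finally show ?thesis by simp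
  qed
  ultimately show ?thesis
    unfolding disk_automorphism_def R_def[symmetric] L_def[symmetric] using q by simp
qed

section \<open>One global solution followed across the jumps\<close>

theorem theorem4:
  fixes x0 x1 :: real and \<zeta> :: "real \<Rightarrow> complex"
    and n :: nat and y :: "nat \<Rightarrow> real" and r :: "nat \<Rightarrow> complex"
  assumes "x0 < x1"
    and "\<zeta> \<in> Cpw_plus x0 x1"
    and "no_removable_discontinuities x0 x1 \<zeta>"
    and "\<not> continuous_on {x0<..<x1} \<zeta>"
    and "strict_mono_on {0..n + 1} y"
    and "y 0 = x0"
    and "y (n + 1) = x1"
    and "y ` {1..n} = {x \<in> {x0<..<x1}. \<not> isCont \<zeta> x}"
    and "\<And>j. j \<in> {1..n} \<Longrightarrow>
      r j = (Lim (at_left (y j)) \<zeta> - Lim (at_right (y j)) \<zeta>) /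
            (Lim (at_left (y j)) \<zeta> + Lim (at_right (y j)) \<zeta>)"
  shows "AE \<omega> in lborel. \<forall>\<xi>\<in>ball 0 1.
    reflection_coeff x0 x1 \<zeta> \<omega> \<xi> =
    foldr (\<lambda>j F. reflection_coeff (y (j - 1)) (y j) \<zeta> \<omega> \<circ> disk_automorphism 1 (r j) \<circ> F)
      [1..<n + 1] (reflection_coeff (y n) (y (n + 1)) \<zeta> \<omega>) \<xi>"
proof -
  have Cpw: "\<zeta> \<in> Cpw x0 x1" using assms(2) by (simp add: Cpw_plus_def)
  obtain \<epsilon> where "\<epsilon> > 0" and ae: "AE x\<in>{x0<..<x1} in lborel. \<zeta> x \<in> \<real> \<and> Re (\<zeta> x) > \<epsilon>"
    using assms(2) by (auto simp: Cpw_plus_def Reg_plus_def)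
  obtain B where B: "\<And>x. x \<in> {x0<..<x1} \<Longrightarrow> norm (\<zeta> x) \<le> B"
    using Cpw_bounded[OF Cpw] \<open>x0 < x1\<close> by (metis less_imp_le)
  have coeff: "coeff_between \<epsilon> B x0 x1 \<zeta>"
    unfolding coeff_between_def using ae by (rule eventually_mono) (use B in auto)
  define kr where "kr c = Lim (at_right c) \<zeta>" for c
  define kl where "kl c = Lim (at_left c) \<zeta>" for c
  have kr_lim: "(\<zeta> \<longlongrightarrow> kr c) (at_right c)" if "x0 \<le> c" "c < x1" for c
    unfolding kr_def by (rule Cpw_tendsto_at_right[OF Cpw that])
  have kl_lim: "(\<zeta> \<longlongrightarrow> kl c) (at_left c)" if "x0 < c" "c \<le> x1" for c
    unfolding kl_def by (rule Cpw_tendsto_at_left[OF Cpw that])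
  have kr: "kr c \<in> \<real>" "0 < Re (kr c)" if "x0 \<le> c" "c < x1" for c
    using coeff_between_tendsto_at_right[OF coeff that kr_lim[OF that]] \<open>\<epsilon> > 0\<close> by auto
  have kl: "kl c \<in> \<real>" "0 < Re (kl c)" if "x0 < c" "c \<le> x1" for c
    using coeff_between_tendsto_at_left[OF coeff that kl_lim[OF that]] \<open>\<epsilon> > 0\<close> by auto
  define D where "D = y ` {1..n}"
  have "finite D" by (simp add: D_def)
  \<comment> \<open>The almost-everywhere lower bound becomes pointwise at points of continuity,
    where the value is a one-sided limit.\<close>
  have D: "isCont \<zeta> x" "\<epsilon> \<le> norm (\<zeta> x) \<and> norm (\<zeta> x) \<le> B" if x: "x \<in> {x0<..<x1} - D" for x
  proof -
    show c: "isCont \<zeta> x" using x assms(8) by (auto simp: D_def)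
    then have "(\<zeta> \<longlongrightarrow> \<zeta> x) (at_right x)"
      by (simp add: isCont_def filterlim_at_split)
    from coeff_between_tendsto_at_right[OF coeff _ _ this] have "\<epsilon> \<le> Re (\<zeta> x)" using x by auto
    then show "\<epsilon> \<le> norm (\<zeta> x) \<and> norm (\<zeta> x) \<le> B"
      using B x complex_Re_le_cmod order_trans by blast
  qed
  have y_less: "y i < y j" if "i < j" "j \<le> n + 1" for i j
    using assms(5) that by (auto simp: strict_mono_on_def)
  have y_ge: "x0 \<le> y j" if "j \<le> n + 1" for j
    using y_less[of 0 j] that assms(6) by (cases "j = 0") auto
  have y_le: "y j \<le> x1" if "j \<le> n + 1" for j
    using y_less[of j "n + 1"] that assms(7) by (cases "j = n + 1") auto
  have main: "reflection_coeff x0 x1 \<zeta> \<omega> \<xi> =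
    foldr (\<lambda>j F. reflection_coeff (y (j - 1)) (y j) \<zeta> \<omega> \<circ> disk_automorphism 1 (r j) \<circ> F)
      [1..<n + 1] (reflection_coeff (y n) (y (n + 1)) \<zeta> \<omega>) \<xi>"
    if "\<omega> \<noteq> 0" and \<xi>: "\<xi> \<in> ball 0 1" for \<omega> \<xi>
  proof -
    define k1 where "k1 = kl x1"
    have k1: "k1 \<in> \<real>" "0 < Re k1" "k1 \<noteq> 0"
      using kl[of x1] \<open>x0 < x1\<close> by (auto simp: k1_def)
    \<comment> \<open>Data with right-going amplitude 1 and left-going amplitude \<xi> at
      \<open>x1\<close>.\<close>
    define ub where "ub = 1 + \<xi>"
    define vb where "vb = \<i> * of_real \<omega> * k1 * (1 - \<xi>)"
    have b1: "right_wave \<omega> k1 ub vb = 1" "left_wave \<omega> k1 ub vb = \<xi>"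
      using k1 \<open>\<omega> \<noteq> 0\<close> by (simp_all add: right_wave_def left_wave_def ub_def vb_def)
    obtain u v where w: "wave_pair x0 x1 \<zeta> \<omega> u v"
      and ub: "(u \<longlongrightarrow> ub) (at_left x1)" and vb: "(v \<longlongrightarrow> vb) (at_left x1)"
      using wave_pair_exists[OF \<open>x0 < x1\<close> \<open>finite D\<close> \<open>\<epsilon> > 0\<close> D] by metis
    have ac: "abs_cont_on {x0<..<x1} u" "abs_cont_on {x0<..<x1} v" using w by (auto simp: wave_pair_def)
    \<comment> \<open>One function supplies both the left and the right limits: the components do
      not see the jumps of \<zeta>.\<close>
    have ext: "\<exists>g. (\<forall>c\<in>{x0..<x1}. (f \<longlongrightarrow> g c) (at_right c)) \<and> (\<forall>c\<in>{x0<..x1}. (f \<longlongrightarrow> g c) (at_left c))"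
      if f: "abs_cont_on {x0<..<x1} f" for f :: "real \<Rightarrow> complex"
    proof -
      obtain l m where lm: "(f \<longlongrightarrow> l) (at_right x0)" "(f \<longlongrightarrow> m) (at_left x1)"
        using abs_cont_on_tendsto_endpoints[OF f \<open>x0 < x1\<close>] by blast
      have "continuous_on {x0<..<x1} f"
        by (intro uniformly_continuous_imp_continuous abs_cont_on_imp_uniformly_continuous_on f)
           (simp add: is_interval_oo)
      then have "isCont f c" if "c \<in> {x0<..<x1}" for c
        using that by (simp add: continuous_on_eq_continuous_at)
      then have i: "(f \<longlongrightarrow> f c) (at_left c)" "(f \<longlongrightarrow> f c) (at_right c)" if "c \<in> {x0<..<x1}" for c
        using that by (simp_all add: isCont_def filterlim_at_split)
      show ?thesis
        by (rule exI[of _ "\<lambda>c. if c = x0 then l else if c = x1 then m else f c"])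
           (use lm i \<open>x0 < x1\<close> in auto)
    qed
    from ext[OF ac(1)] obtain U where U: "\<And>c. c \<in> {x0..<x1} \<Longrightarrow> (u \<longlongrightarrow> U c) (at_right c)"
      "\<And>c. c \<in> {x0<..x1} \<Longrightarrow> (u \<longlongrightarrow> U c) (at_left c)" by blast
    from ext[OF ac(2)] obtain V where V: "\<And>c. c \<in> {x0..<x1} \<Longrightarrow> (v \<longlongrightarrow> V c) (at_right c)"
      "\<And>c. c \<in> {x0<..x1} \<Longrightarrow> (v \<longlongrightarrow> V c) (at_left c)" by blast
    have U1: "U x1 = ub" using tendsto_unique[OF trivial_limit_at_left_real U(2)[of x1] ub] \<open>x0 < x1\<close> by simp
    have V1: "V x1 = vb" using tendsto_unique[OF trivial_limit_at_left_real V(2)[of x1] vb] \<open>x0 < x1\<close> by simp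
    define \<Phi> where "\<Phi> = Im (v ((x0 + x1) / 2) * cnj (u ((x0 + x1) / 2)))"
    have "(x0 + x1) / 2 \<in> {x0<..<x1}" using \<open>x0 < x1\<close> by simp
    then have "Im (v x * cnj (u x)) \<in> {\<Phi>}" if "x \<in> {x0<..<x1}" for x
      using wave_pair_flux_constant[OF w coeff that] by (simp add: \<Phi>_def)
    then have \<Phi>: "AE x\<in>{x0<..<x1} in lborel. Im (v x * cnj (u x)) \<in> {\<Phi>}" by blast
    have flux: "Im (V c * cnj (U c)) = \<Phi>" if c: "c \<in> {x0..x1}" for c
    proof (cases "c = x1")
      case True
      then have c': "c \<in> {x0<..x1}" using \<open>x0 < x1\<close> by simp
      then have "((\<lambda>x. Im (v x * cnj (u x))) \<longlongrightarrow> Im (V c * cnj (U c))) (at_left c)"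
        by (intro tendsto_Im tendsto_mult tendsto_cnj U V)
      from AE_tendsto_at_left_closed[OF \<Phi> closed_singleton _ _ this] c' show ?thesis by simp
    next
      case False
      then have c': "c \<in> {x0..<x1}" using c by simp
      then have "((\<lambda>x. Im (v x * cnj (u x))) \<longlongrightarrow> Im (V c * cnj (U c))) (at_right c)"
        by (intro tendsto_Im tendsto_mult tendsto_cnj U V)
      from AE_tendsto_at_right_closed[OF \<Phi> closed_singleton _ _ this] c' show ?thesis by simp
    qed
    have "\<Phi> = \<omega> * Re k1 * (1 - (norm \<xi>)\<^sup>2)"
      using flux[of x1] flux_eq_norm_waves[OF \<open>\<omega> \<noteq> 0\<close> k1(1,3), of vb ub] \<open>x0 < x1\<close>
      by (simp add: U1 V1 b1)
    moreover have "(norm \<xi>)\<^sup>2 < 1" using \<xi> by (simp add: power_less_one_iff)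
    ultimately have \<Phi>_pos: "\<Phi> / \<omega> > 0" using k1 \<open>\<omega> \<noteq> 0\<close> by simp
    \<comment> \<open>A vanishing right-going amplitude would give \<Phi> the sign opposite to
      \<omega> or make it zero. The claim covers every positive real \<open>k\<close>, hence both
      one-sided values of \<zeta> at a jump.\<close>
    have R0: "right_wave \<omega> k (U c) (V c) \<noteq> 0" if "c \<in> {x0..x1}" "k \<in> \<real>" "0 < Re k" for c k
    proof
      have "k \<noteq> 0" using that by auto
      assume "right_wave \<omega> k (U c) (V c) = 0"
      then have "\<Phi> = \<omega> * (Re k * (- (norm (left_wave \<omega> k (U c) (V c)))\<^sup>2))"
        using flux[OF that(1)] flux_eq_norm_waves[OF \<open>\<omega> \<noteq> 0\<close> that(2) \<open>k \<noteq> 0\<close>, of "V c" "U c"]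
        by simp
      then have "\<Phi> / \<omega> = - (Re k * (norm (left_wave \<omega> k (U c) (V c)))\<^sup>2)"
        using \<open>\<omega> \<noteq> 0\<close> by simp
      moreover have "Re k * (norm (left_wave \<omega> k (U c) (V c)))\<^sup>2 \<ge> 0" using that by simp
      ultimately show False using \<Phi>_pos by linarith
    qed
    \<comment> \<open>\<open>s c\<close> and \<open>t c\<close> are the quotients of the amplitudes
      just left and just right of \<open>c\<close>.\<close>
    define s where "s c = left_wave \<omega> (kl c) (U c) (V c) / right_wave \<omega> (kl c) (U c) (V c)" for c
    define t where "t c = left_wave \<omega> (kr c) (U c) (V c) / right_wave \<omega> (kr c) (U c) (V c)" for c
    \<comment> \<open>Stated for arbitrary subintervals, so that it applies to each piece and to the
      whole interval.\<close>
    have refl: "reflection_coeff c d \<zeta> \<omega> (s d) = t c" if "x0 \<le> c" "c < d" "d \<le> x1" for c d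
      unfolding t_def
    proof (rule reflection_coeff_eq[OF \<open>c < d\<close> \<open>\<omega> \<noteq> 0\<close> _ \<open>\<epsilon> > 0\<close>])
      show "coeff_between \<epsilon> B c d \<zeta>" by (rule coeff_between_subinterval[OF coeff that(1,3)])
      show "wave_pair c d \<zeta> \<omega> u v" by (rule wave_pair_subinterval[OF w that(1,3)])
      show "left_wave \<omega> (kl d) (U d) (V d) = s d * right_wave \<omega> (kl d) (U d) (V d)"
        using R0[of d "kl d"] kl[of d] that by (simp add: s_def)
    qed (use that kr_lim kl_lim U V R0[of c "kr c"] kr[of c] in auto)
    have s1: "s x1 = \<xi>" using b1 by (simp add: s_def U1 V1 k1_def)
    have jump: "disk_automorphism 1 (r j) (t (y j)) = s (y j)" if j: "j \<in> {1..n}" for j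
    proof -
      have yj: "x0 < y j" "y j < x1"
        using y_less[of 0 j] y_less[of j "n + 1"] j assms(6,7) by auto
      have "kl (y j) + kr (y j) \<noteq> 0"
        using kl(2)[of "y j"] kr(2)[of "y j"] yj by (auto simp: complex_eq_iff)
      then show ?thesis
        unfolding t_def s_def assms(9)[OF j] kr_def[symmetric] kl_def[symmetric]
        using kl[of "y j"] kr[of "y j"] yj R0[of "y j" "kr (y j)"]
        by (intro disk_automorphism_waves \<open>\<omega> \<noteq> 0\<close>) auto
    qed
    let ?f = "\<lambda>j F. reflection_coeff (y (j - 1)) (y j) \<zeta> \<omega> \<circ> disk_automorphism 1 (r j) \<circ> F"
    let ?G = "reflection_coeff (y n) (y (n + 1)) \<zeta> \<omega>"
    \<comment> \<open>Downward induction on \<open>j\<close>, from the empty list at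
      \<open>n + 1\<close>, where only the last piece acts. The factors from \<open>j\<close> on
      carry \<xi> from \<open>x1\<close> to the quotient just right of
      \<open>y (j - 1)\<close>.\<close>
    have "foldr ?f [j..<n + 1] ?G \<xi> = t (y (j - 1))" if "1 \<le> j" "j \<le> n + 1" for j
      using that(2,1)
    proof (induction rule: inc_induct)
      case base
      show ?case using refl[of "y n" "y (n + 1)"] y_ge[of n] y_less[of n "n + 1"] s1 assms(7) by simp
    next
      case (step i)
      have IH: "foldr ?f [Suc i..<n + 1] ?G \<xi> = t (y i)"
        using step.IH step.prems by (simp only: diff_Suc_Suc diff_zero le_SucI One_nat_def)
      have "foldr ?f [i..<n + 1] ?G \<xi> = ?f i (foldr ?f [Suc i..<n + 1] ?G) \<xi>"
        using step.hyps by (simp add: upt_conv_Cons del: upt_Suc)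
      also have "\<dots> = reflection_coeff (y (i - 1)) (y i) \<zeta> \<omega> (disk_automorphism 1 (r i) (t (y i)))"
        by (simp only: comp_apply IH)
      also have "\<dots> = reflection_coeff (y (i - 1)) (y i) \<zeta> \<omega> (s (y i))"
        using jump[of i] step by simp
      also have "\<dots> = t (y (i - 1))"
        by (rule refl) (use y_ge[of "i - 1"] y_less[of "i - 1" i] y_le[of i] step in auto)
      finally show ?case .
    qed
    \<comment> \<open>Both sides equal \<open>t x0\<close>: the composition by the induction, the
      left-hand side by \<open>refl\<close> on the whole interval.\<close>
    from this[of 1] show ?thesis using refl[of x0 x1] \<open>x0 < x1\<close> s1 assms(6) by simp
  qed
  show ?thesis
    using AE_lborel_singleton[of 0] by (rule eventually_mono) (use main in blast)
qed

end
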